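(* Let $0<d<\pi/2$. Let $\tilde f$ be a function with boundary values $p=\lim_{t\to\infty}\tilde f(t)$ and $q=\lim_{t\to 0}\tilde f(t)$ (limits along $t\in(0,\infty)$), and define $$f(z)=\tilde f(z)-\frac{q+p(e^z-1)}{e^z}.$$ Assume that $f$ is analytic in $\phi(\mathscr{D}_d)$, and that there exist positive constants $C_{\ddagger}$ and $\mu$ with $\mu\le 1$ such that $|f(z)|\le C_{\ddagger}|z|^{\mu}|e^{-z}|^{\mu}$ for all $z\in\phi(\mathscr{D}_d)$. For a positive integer $n$ let $h=\operatorname{arsinh}(dn/\mu)/n$. Then there exists a positive constant $C$ independent of $n$ such that $$\sup_{t\in(0,\infty)}\left|\tilde f(t)-\left[\frac{q+p(e^t-1)}{e^t}+\sum_{j=-n}^{n}\left\{\tilde f(\phi(jh))-\frac{q+pe^{\pi\sinh(jh)}}{1+e^{\pi\sinh(jh)}}\right\}S(j,h)(\phi^{-1}(t))\right]\right|\le C e^{-\pi dn/\operatorname{arsinh}(dn/\mu)}.$$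
   Context: For $d>0$, $\mathscr{D}_d=\{\zeta\in\mathbb{C}:|\operatorname{Im}\zeta|<d\}$. The DE transformation is $\phi(\zeta)=\log(1+e^{\pi\sinh\zeta})$, where the logarithm is taken so that $\phi$ is analytic on $\mathscr{D}_{\pi/2}$ and real on $\mathbb{R}$; $\phi$ maps $\mathbb{R}$ bijectively onto $(0,\infty)$, $\phi^{-1}:(0,\infty)\to\mathbb{R}$ is the inverse of $\phi|_{\mathbb{R}}$, and $\phi(\mathscr{D}_d)=\{\phi(\zeta):\zeta\in\mathscr{D}_d\}$. The Sinc function is $S(j,h)(x)=\frac{\sin[\pi(x-jh)/h]}{\pi(x-jh)/h}$ (equal to $1$ at $x=jh$). *)

theory Defs
  imports "HOL-Complex_Analysis.Complex_Analysis"
begin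

definition strip :: "real \<Rightarrow> complex set"
  where "strip d = {\<zeta>. \<bar>Im \<zeta>\<bar> < d}"

(* The principal branch Ln is not the right one here: 1 + exp (pi * sinh \<zeta>) crosses the
   negative real axis on strip (pi/2). The branch is therefore specified as in the mathematics:
   an analytic logarithm on strip (pi/2) that is real on the real line. It exists and is unique
   on strip (pi/2) (DE_phi_spec, DE_phi_unique); values outside this strip are irrelevant. *)
definition is_DE_map :: "(complex \<Rightarrow> complex) \<Rightarrow> bool"
  where "is_DE_map g \<longleftrightarrow>
    g holomorphic_on strip (pi/2) \<and>
    (\<forall>\<zeta>\<in>strip (pi/2). exp (g \<zeta>) = 1 + exp (of_real pi * sinh \<zeta>)) \<and>
    (\<forall>x::real. g (of_real x) \<in> \<real>)"

definition DE_phi :: "complex \<Rightarrow> complex"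
  where "DE_phi = (SOME g. is_DE_map g)"

(* inverse of the restriction of DE_phi to the real line, meaningful for t > 0 *)
definition DE_phi_inv :: "real \<Rightarrow> real"
  where "DE_phi_inv t = (THE x. DE_phi (of_real x) = of_real t)"

definition Sinc :: "int \<Rightarrow> real \<Rightarrow> real \<Rightarrow> real"
  where "Sinc j h x =
    (if x = of_int j * h then 1
     else sin (pi * (x - of_int j * h) / h) / (pi * (x - of_int j * h) / h))"

lemma one_plus_exp_pi_sinh_nonzero:
  assumes "\<zeta> \<in> strip (pi/2)"
  shows "1 + exp (of_real pi * sinh \<zeta>) \<noteq> 0"
proof
  assume *: "1 + exp (of_real pi * sinh \<zeta>) = 0"
  define w where "w = of_real pi * sinh \<zeta>"
  have e: "exp w = exp (\<i> * of_real pi)"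
    using * by (simp add: w_def add_eq_0_iff)
  then obtain n :: int where n: "w = \<i> * of_real pi + (of_int (2 * n) * of_real pi) * \<i>"
    unfolding exp_eq by auto
  have re: "Re w = 0" and im: "Im w = (2 * of_int n + 1) * pi"
    by (simp_all add: n algebra_simps)
  have s: "Re (sinh \<zeta>) = 0" "Im (sinh \<zeta>) = 2 * of_int n + 1"
    using re im by (simp_all add: w_def)
  have sv: "Re (sinh \<zeta>) = sinh (Re \<zeta>) * cos (Im \<zeta>)"
           "Im (sinh \<zeta>) = cosh (Re \<zeta>) * sin (Im \<zeta>)"
    by (simp_all add: sinh_def cosh_def Re_exp Im_exp algebra_simps)
  have y: "\<bar>Im \<zeta>\<bar> < pi/2" using assms by (simp add: strip_def)
  have "cos (Im \<zeta>) > 0" using y by (intro cos_gt_zero_pi) auto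
  hence "Re \<zeta> = 0" using s sv by simp
  hence i: "sin (Im \<zeta>) = 2 * of_int n + 1" using s sv by simp
  have "\<bar>sin (Im \<zeta>)\<bar> < 1"
  proof -
    have "(sin (Im \<zeta>))\<^sup>2 < 1"
      using \<open>cos (Im \<zeta>) > 0\<close> sin_cos_squared_add[of "Im \<zeta>"]
      by (smt (verit) zero_less_power)
    thus ?thesis by (simp add: abs_square_less_1)
  qed
  hence "\<bar>of_int (2 * n + 1) :: real\<bar> < of_int 1" using i by simp
  hence "\<bar>2 * n + 1\<bar> < 1" by linarith
  thus False by presburger
qed

lemma strip_convex: "convex (strip d)"
proof -
  have "strip d = {\<zeta>. Im \<zeta> < d} \<inter> {\<zeta>. Im \<zeta> > -d}" by (auto simp: strip_def)
  thus ?thesis by (simp add: convex_Int convex_halfspace_Im_lt convex_halfspace_Im_gt)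
qed

lemma strip_open: "open (strip d)"
proof -
  have "strip d = {\<zeta>. Im \<zeta> < d} \<inter> {\<zeta>. Im \<zeta> > -d}" by (auto simp: strip_def)
  thus ?thesis by (simp add: open_Int open_halfspace_Im_lt open_halfspace_Im_gt)
qed

lemma of_real_in_strip: "d > 0 \<Longrightarrow> of_real x \<in> strip d"
  by (simp add: strip_def)

lemma sinh_of_real_complex: "sinh (complex_of_real x) = of_real (sinh x)"
  by (simp add: sinh_def exp_of_real scaleR_conv_of_real flip: of_real_minus)

lemma cosh_of_real_complex: "cosh (complex_of_real x) = of_real (cosh x)"
  by (simp add: cosh_def exp_of_real scaleR_conv_of_real flip: of_real_minus)

lemma one_plus_exp_of_real:
  "1 + exp (of_real pi * sinh (complex_of_real x)) = of_real (1 + exp (pi * sinh x))"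
  by (simp add: sinh_of_real_complex flip: exp_of_real of_real_mult)

lemma is_DE_map_of_real:
  assumes "is_DE_map g"
  shows "g (of_real x) = of_real (ln (1 + exp (pi * sinh x)))"
proof -
  obtain y where y: "g (of_real x) = of_real y"
    using assms unfolding is_DE_map_def by (meson Reals_cases)
  have "exp (g (of_real x)) = of_real (1 + exp (pi * sinh x))"
    using assms one_plus_exp_of_real[of x] of_real_in_strip[of "pi/2" x] pi_gt_zero
    unfolding is_DE_map_def by (metis half_gt_zero)
  hence "complex_of_real (exp y) = of_real (1 + exp (pi * sinh x))"
    by (simp add: y exp_of_real)
  hence "exp y = 1 + exp (pi * sinh x)" by (simp only: of_real_eq_iff)
  thus ?thesis using y by (metis ln_exp)
qed

lemma is_DE_map_exists: "\<exists>g. is_DE_map g"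
proof -
  let ?F = "\<lambda>\<zeta>. 1 + exp (of_real pi * sinh \<zeta>)"
  have hol: "?F holomorphic_on strip (pi/2)"
    unfolding sinh_def by (intro holomorphic_intros)
  obtain g0 where g0: "g0 holomorphic_on strip (pi/2)"
      "\<And>z. z \<in> strip (pi/2) \<Longrightarrow> ?F z = exp (g0 z)"
    using contractible_imp_holomorphic_log[OF hol convex_imp_contractible[OF strip_convex]]
      one_plus_exp_pi_sinh_nonzero by metis
  define c where "c = g0 0 - of_real (ln 2)"
  define g where "g = (\<lambda>z. g0 z - c)"
  have z0: "0 \<in> strip (pi/2)" by (simp add: strip_def)
  have "exp c = 1"
    using g0(2)[OF z0] by (simp add: c_def exp_diff exp_of_real)
  hence ex: "exp (g z) = ?F z" if "z \<in> strip (pi/2)" for z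
    using g0(2)[OF that] by (simp add: g_def exp_diff)
  have gh: "g holomorphic_on strip (pi/2)"
    unfolding g_def by (intro holomorphic_intros g0)
  define L where "L = (\<lambda>x::real. ln (1 + exp (pi * sinh x)))"
  have pos: "1 + exp (pi * sinh x) > 0" for x :: real by (simp add: add_pos_pos)
  have gd: "(g has_field_derivative deriv g z) (at z)" if "z \<in> strip (pi/2)" for z
    using gh that strip_open holomorphic_derivI by blast
  have dg: "deriv g z * exp (g z) = exp (of_real pi * sinh z) * (of_real pi * cosh z)"
    if "z \<in> strip (pi/2)" for z
  proof -
    have a: "((\<lambda>z. exp (g z)) has_field_derivative (exp (g z) * deriv g z)) (at z)"
      using gd[OF that] by (auto intro!: derivative_eq_intros)
    have b: "(?F has_field_derivative exp (of_real pi * sinh z) * (of_real pi * cosh z)) (at z)"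
      by (auto intro!: derivative_eq_intros)
    have "((\<lambda>z. exp (g z)) has_field_derivative
             exp (of_real pi * sinh z) * (of_real pi * cosh z)) (at z)"
      by (rule has_field_derivative_transform_within_open[OF b strip_open that])
         (simp add: ex)
    from DERIV_unique[OF a this] show ?thesis by (simp add: mult.commute)
  qed
  have real: "g (of_real x) = of_real (L x)" for x :: real
  proof -
    have vd: "((\<lambda>x. g (of_real x) - of_real (L x)) has_vector_derivative 0) (at x)" for x :: real
    proof -
      have m: "of_real x \<in> strip (pi/2)" by (simp add: of_real_in_strip)
      have e1: "exp (complex_of_real pi * of_real (sinh x)) = of_real (exp (pi * sinh x))"
        by (simp flip: exp_of_real)
      have "deriv g (of_real x) * of_real (1 + exp (pi * sinh x)) =
          of_real (exp (pi * sinh x) * (pi * cosh x))"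
        using dg[OF m] unfolding ex[OF m] one_plus_exp_of_real
        by (simp add: sinh_of_real_complex cosh_of_real_complex e1)
      hence d: "deriv g (of_real x) =
          of_real (exp (pi * sinh x) * (pi * cosh x)) / of_real (1 + exp (pi * sinh x))"
        using pos[of x] by (simp only: eq_divide_eq) (metis of_real_eq_0_iff less_irrefl)
      have ld: "(L has_field_derivative
          exp (pi * sinh x) * (pi * cosh x) / (1 + exp (pi * sinh x))) (at x)"
        unfolding L_def using pos[of x]
        by (auto intro!: derivative_eq_intros simp: field_simps)
      have 1: "((\<lambda>x. g (of_real x)) has_vector_derivative deriv g (of_real x)) (at x)"
        by (rule has_vector_derivative_real_field) (rule gd[OF m])
      have 2: "((\<lambda>x. complex_of_real (L x)) has_vector_derivative deriv g (of_real x)) (at x)"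
        using has_vector_derivative_of_real[OF ld, where ?'a = complex]
        unfolding d of_real_divide[symmetric] by blast
      show ?thesis using has_vector_derivative_diff[OF 1 2] by simp
    qed
    have "(\<lambda>x. g (of_real x) - of_real (L x)) x = (\<lambda>x. g (of_real x) - of_real (L x)) 0"
    proof -
      obtain k where "\<And>x. x \<in> UNIV \<Longrightarrow> g (of_real x) - of_real (L x) = k"
        using has_vector_derivative_zero_constant[of UNIV "\<lambda>x. g (of_real x) - of_real (L x)"] vd
        by (metis convex_UNIV)
      thus ?thesis by (metis UNIV_I)
    qed
    thus ?thesis by (simp add: L_def g_def c_def)
  qed
  have "is_DE_map g"
    unfolding is_DE_map_def using gh ex real by simp
  thus ?thesis by blast
qed

lemma DE_phi_spec: "is_DE_map DE_phi"
  unfolding DE_phi_def using is_DE_map_exists by (rule someI_ex)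

lemma DE_phi_unique:
  assumes "is_DE_map g" "\<zeta> \<in> strip (pi/2)"
  shows "g \<zeta> = DE_phi \<zeta>"
proof (rule analytic_continuation[where f = "\<lambda>z. g z - DE_phi z" and \<xi> = 0
      and U = "range complex_of_real" and S = "strip (pi/2)", simplified])
  show "(\<lambda>z. g z - DE_phi z) holomorphic_on strip (pi/2)"
    using assms(1) DE_phi_spec by (auto simp: is_DE_map_def intro!: holomorphic_intros)
  show "open (strip (pi/2))" by (rule strip_open)
  show "connected (strip (pi/2))" by (rule convex_connected[OF strip_convex])
  show "range complex_of_real \<subseteq> strip (pi/2)" by (auto simp: of_real_in_strip)
  show "0 \<in> strip (pi/2)" by (simp add: strip_def)
  show "0 islimpt range complex_of_real"
  proof (rule islimptI)
    fix T :: "complex set" assume "0 \<in> T" "open T"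
    then obtain e where e: "e > 0" "ball 0 e \<subseteq> T" using openE by blast
    have "complex_of_real (e/2) \<in> ball 0 e" using e(1) by (simp del: of_real_divide)
    thus "\<exists>y\<in>range complex_of_real. y \<in> T \<and> y \<noteq> 0"
      using e by (intro bexI[of _ "complex_of_real (e/2)"] rangeI) auto
  qed
  show "g z = DE_phi z" if "z \<in> range complex_of_real" for z
    using that is_DE_map_of_real[OF assms(1)] is_DE_map_of_real[OF DE_phi_spec] by auto
  show "\<zeta> \<in> strip (pi/2)" by (rule assms(2))
qed

lemma DE_phi_of_real: "DE_phi (of_real x) = of_real (ln (1 + exp (pi * sinh x)))"
  by (rule is_DE_map_of_real[OF DE_phi_spec])

lemma DE_phi_real_bij:
  assumes "t > 0"
  shows "\<exists>!x::real. DE_phi (of_real x) = of_real t"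
proof -
  have eq: "DE_phi (of_real x) = of_real t \<longleftrightarrow> x = arsinh (ln (exp t - 1) / pi)" for x
  proof -
    have "1 + exp (pi * sinh x) > 0" by (simp add: add_pos_pos)
    hence "DE_phi (of_real x) = of_real t \<longleftrightarrow> 1 + exp (pi * sinh x) = exp t"
      unfolding DE_phi_of_real of_real_eq_iff by (metis exp_ln ln_exp)
    also have "\<dots> \<longleftrightarrow> exp (pi * sinh x) = exp t - 1" by auto
    also have "\<dots> \<longleftrightarrow> pi * sinh x = ln (exp t - 1)"
      using assms by (metis exp_ln ln_exp diff_gt_0_iff_gt one_less_exp_iff)
    also have "\<dots> \<longleftrightarrow> sinh x = ln (exp t - 1) / pi" by (auto simp: field_simps)
    also have "\<dots> \<longleftrightarrow> x = arsinh (ln (exp t - 1) / pi)"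
      by (metis arsinh_sinh_real sinh_arsinh_real)
    finally show ?thesis .
  qed
  show ?thesis unfolding eq by auto
qed

end

theory Submission
  imports Defs "HOL-Real_Asymp.Real_Asymp"
begin

text \<open>
  Put F = f \<circ> \<phi>. Substituting t = \<phi>(x), the subtracted boundary terms match the ones in
  the definition of f, so the quantity to estimate is the error
  F(x) - \<Sum>_{|j| \<le> n} F(jh) S(j,h)(x) of a truncated cardinal series, for real x.

  \<^emph>\<open>Decay.\<close> On the strip, F is bounded by a multiple of
  |\<phi> e^{-\<phi>}|^\<mu>. At one end of the strip e^{-\<phi>} decays double exponentially and
  \<phi> grows only single exponentially; at the other end \<phi> decays and e^{-\<phi>} is
  bounded. This gives |F(z)| \<le> K exp(-a|sinh(Re z)|) for some a > 0
  (DE_phi_exp_bound).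

  \<^emph>\<open>Discretization.\<close> The residue theorem, applied to
  F(z)/((z-x) sin(\<pi>z/h)) on rectangles that exhaust the strip, expresses the error of the full
  cardinal series by integrals over the boundary of the strip. There
  |sin(\<pi>z/h)| \<ge> sinh(\<pi>d/h), which yields an error of order e^{-\<pi>d/h}, precisely the
  claimed rate, since \<pi>d/h = \<pi>dn/arsinh(dn/\<mu>)
  (truncated_cardinal_series_error).

  \<^emph>\<open>Truncation.\<close> The step size is chosen such that sinh(nh) = dn/\<mu>, so the
  neglected terms sum to at most a multiple of n e^{-adn/\<mu>} (sum_double_exponential_tail). The
  claimed rate is only e^{-o(n)}, so this is negligible for every a > 0, and a crude value of
  a in the decay estimate is enough.
\<close>

section \<open>The error of the truncated cardinal series on a strip\<close>

text \<open>
  This identity separates the two ways in which the sine is kept away from zero: on horizontal lines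
  by its hyperbolic part, which supplies the factor e^{-\<pi>d/h} of the interpolation error, and on
  the vertical lines half-way between two zeros by its trigonometric part, which equals one there.
\<close>

lemma cmod_sin_squared:
  "(cmod (sin z))\<^sup>2 = (sin (Re z))\<^sup>2 + (sinh (Im z))\<^sup>2"
proof -
  have "(cmod (sin z))\<^sup>2 = (sin (Re z) * cosh (Im z))\<^sup>2 + (cos (Re z) * sinh (Im z))\<^sup>2"
    by (simp add: cmod_power2 Re_sin Im_sin cosh_def sinh_def mult.commute)
  also have "\<dots> = (sin (Re z))\<^sup>2 + (sinh (Im z))\<^sup>2"
    unfolding power_mult_distrib cosh_square_eq cos_squared_eq by (simp add: algebra_simps)
  finally show ?thesis .
qed

lemma sinh_abs_le_cmod_sin: "sinh \<bar>Im z\<bar> \<le> cmod (sin z)"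
proof (rule power2_le_imp_le)
  have "(sinh \<bar>Im z\<bar>)\<^sup>2 = (sinh (Im z))\<^sup>2" by (cases "Im z \<ge> 0") auto
  thus "(sinh \<bar>Im z\<bar>)\<^sup>2 \<le> (cmod (sin z))\<^sup>2" by (simp add: cmod_sin_squared)
qed simp

lemma cmod_sin_ge_1:
  assumes "cos (Re z) = 0" shows "1 \<le> cmod (sin z)"
proof (rule power2_le_imp_le)
  have "(sin (Re z))\<^sup>2 = 1" using sin_cos_squared_add[of "Re z"] assms by simp
  thus "1\<^sup>2 \<le> (cmod (sin z))\<^sup>2" by (simp add: cmod_sin_squared)
qed simp

text \<open>
  The numerator may vanish at the point, as a function can vanish at an interpolation node. The pole
  of the quotient is then removable and both sides are zero, so the residue is computed as a limit,
  without reference to the order of the pole.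
\<close>

lemma residue_at_simple_zero_of_denominator:
  assumes "open S" "z \<in> S" and f: "f holomorphic_on S" and g: "g holomorphic_on S"
    and nz: "\<And>w. w \<in> S - {z} \<Longrightarrow> g w \<noteq> 0"
    and g': "(g has_field_derivative g') (at z)" "g z = 0" "g' \<noteq> 0"
  shows "residue (\<lambda>w. f w / g w) z = f z / g'"
proof (rule residue_simple'[OF assms(1,2)])
  show "(\<lambda>w. f w / g w) holomorphic_on S - {z}"
    using nz by (intro holomorphic_intros holomorphic_on_subset[OF f] holomorphic_on_subset[OF g]) auto
  have "isCont f z"
    using f assms(1,2) continuous_on_eq_continuous_at holomorphic_on_imp_continuous_on by blast
  hence "(f \<longlongrightarrow> f z) (at z)" by (simp add: isCont_def)
  moreover have "((\<lambda>w. (g w - g z) / (w - z)) \<longlongrightarrow> g') (at z)"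
    using g'(1) by (simp add: has_field_derivative_iff)
  ultimately have "((\<lambda>w. f w / ((g w - g z) / (w - z))) \<longlongrightarrow> f z / g') (at z)"
    by (intro tendsto_divide g'(3))
  thus "((\<lambda>w. f w / g w * (w - z)) \<longlongrightarrow> f z / g') (at z)" by (simp add: g'(2))
qed

lemma sin_scaled_eq_0_iff:
  fixes z :: complex and h :: real
  assumes "h > 0"
  shows "sin (of_real (pi / h) * z) = 0 \<longleftrightarrow> (\<exists>j::int. z = of_real (of_int j * h))"
proof -
  have "of_real (pi / h) * z = of_real (of_int j * pi) \<longleftrightarrow> z = of_real (of_int j * h)" for j :: int
    using assms by (auto simp: field_simps)
  thus ?thesis unfolding sin_eq_0 by simp
qed

text \<open>
  Since sin(\<pi>x/h - \<pi>j) = (-1)^j sin(\<pi>x/h), with the sign written as cos(\<pi>j), the Sinc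
  function is the common factor sin(\<pi>x/h) times a quotient in which (\<pi>/h) cos(\<pi>j) is the
  derivative of sin(\<pi>z/h) at the node jh. In this form it is recognised in the residues below.
\<close>

lemma Sinc_eq_alternating:
  assumes "h > 0" "x \<noteq> of_int j * h"
  shows "Sinc j h x = - sin (pi / h * x) / ((of_int j * h - x) * (pi / h * cos (pi * of_int j)))"
proof -
  have s: "sin (pi * of_int j) = 0" by (simp add: mult.commute[of pi] sin_times_pi_eq_0)
  have c: "cos (pi * of_int j) * cos (pi * of_int j) = 1"
    using sin_cos_squared_add[of "pi * of_int j"] by (simp add: s power2_eq_square)
  have arg: "pi * (x - of_int j * h) / h = pi / h * x - pi * of_int j"
    using assms by (simp add: field_simps)
  have "sin (pi * (x - of_int j * h) / h) = sin (pi / h * x) * cos (pi * of_int j)"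
    unfolding arg sin_diff s by simp
  hence "Sinc j h x = sin (pi / h * x) * cos (pi * of_int j) / (pi / h * (x - of_int j * h))"
    using assms(2) by (simp add: Sinc_def)
  also have "\<dots> = - sin (pi / h * x) / ((of_int j * h - x) * (pi / h * cos (pi * of_int j)))"
  proof -
    have "cos (pi * of_int j) \<noteq> 0" using c by auto
    thus ?thesis using assms c by (simp add: divide_simps) (simp add: algebra_simps)
  qed
  finally show ?thesis .
qed

lemma Sinc_abs_le_1: 
  assumes "h > 0" shows "\<bar>Sinc j h x\<bar> \<le> 1"
proof (cases "x = of_int j * h")
  case False
  define u where "u = pi * (x - of_int j * h) / h"
  have "u \<noteq> 0" using assms False by (simp add: u_def)
  moreover have "\<bar>sin u\<bar> \<le> \<bar>u\<bar>" by (rule abs_sin_x_le_abs_x)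
  ultimately show ?thesis using False by (simp add: Sinc_def u_def[symmetric])
qed (simp add: Sinc_def)

lemma Sinc_node: "h > 0 \<Longrightarrow> Sinc j h (of_int k * h) = (if j = k then 1 else 0)"
proof -
  assume h: "h > 0"
  have "pi * (of_int k * h - of_int j * h) / h = pi * of_int (k - j)" using h by (simp add: field_simps)
  thus ?thesis using h by (auto simp: Sinc_def sin_times_pi_eq_0 mult.commute[of pi])
qed

text \<open>
  The interpolation error is a contour integral: the kernel 1/((z-x) sin(\<pi>z/h)) has simple poles
  at x and at the nodes jh, and its residues against F are, up to the factor sin(\<pi>x/h), the
  value F(x) and the negated terms of the cardinal series. The vertical sides pass half-way between
  two nodes, so that exactly the nodes with |j| \<le> N lie inside.
\<close>

lemma rect_contour_integral_sinc:
  fixes F :: "complex \<Rightarrow> complex" and N :: nat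
  assumes F: "F holomorphic_on strip d" and "0 < d'" "d' < d" "h > 0"
    and x: "\<bar>x\<bar> \<le> real N * h" "\<And>j::int. x \<noteq> of_int j * h"
  defines "R \<equiv> (real N + 1/2) * h"
  shows "contour_integral (rectpath (Complex (- R) (- d')) (Complex R d'))
           (\<lambda>z. F z / ((z - of_real x) * sin (of_real (pi / h) * z))) * sin (of_real (pi / h * x))
         = 2 * of_real pi * \<i> *
           (F (of_real x) - (\<Sum>j\<in>{- int N..int N}. F (of_real (of_int j * h)) * of_real (Sinc j h x)))"
proof -
  let ?g = "\<lambda>z::complex. (z - of_real x) * sin (of_real (pi / h) * z)"
  let ?G = "\<lambda>z. F z / ?g z"
  let ?R = "rectpath (Complex (- R) (- d')) (Complex R d')"
  define node where "node = (\<lambda>j::int. complex_of_real (of_int j * h))"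
  define J where "J = {- int N..int N}"
  define pts where "pts = insert (of_real x) (node ` J)"
  \<comment> \<open>A convex region that contains the rectangle and no node beyond those with index in J.\<close>
  define S where "S = strip d \<inter> {z. Re z < (real N + 1) * h} \<inter> {z. Re z > - ((real N + 1) * h)}"
  have oS: "open S" unfolding S_def
    by (intro open_Int strip_open open_halfspace_Re_lt open_halfspace_Re_gt)
  have cS: "convex S" unfolding S_def
    by (intro convex_Int strip_convex convex_halfspace_Re_lt convex_halfspace_Re_gt)
  have FS: "F holomorphic_on S" by (rule holomorphic_on_subset[OF F]) (auto simp: S_def)
  have gS: "?g holomorphic_on A" for A by (intro holomorphic_intros)
  have R: "0 < R" "R < (real N + 1) * h" "real N * h < R" using \<open>h > 0\<close> by (auto simp: R_def)
  have node_R: "\<bar>of_int j * h\<bar> \<le> real N * h" if "j \<in> J" for j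
  proof -
    have "\<bar>real_of_int j\<bar> \<le> real N" using that by (auto simp: J_def)
    thus ?thesis using \<open>h > 0\<close> by (simp add: abs_mult mult_right_mono)
  qed
  have node_J: "j \<in> J" if "\<bar>of_int j * h\<bar> < (real N + 1) * h" for j
  proof -
    have "\<bar>of_int j\<bar> * h < (real N + 1) * h" using that \<open>h > 0\<close> by (simp add: abs_mult)
    hence "\<bar>of_int j\<bar> < real N + 1" using \<open>h > 0\<close> by (simp add: mult_less_cancel_right)
    thus ?thesis by (auto simp: J_def)
  qed
  have zeros: "z \<in> pts" if "z \<in> S" "?g z = 0" for z
  proof (cases "z = of_real x")
    case False
    then obtain j where "z = node j"
      using \<open>?g z = 0\<close> sin_scaled_eq_0_iff[OF \<open>h > 0\<close>, of z] by (auto simp: node_def)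
    moreover from this have "j \<in> J" using \<open>z \<in> S\<close> by (intro node_J) (auto simp: S_def node_def)
    ultimately show ?thesis by (simp add: pts_def)
  qed (simp add: pts_def)
  have pts_box: "z \<in> box (Complex (- R) (- d')) (Complex R d')" if "z \<in> pts" for z
    using that x(1) R node_R \<open>0 < d'\<close> by (fastforce simp: pts_def in_box_complex_iff node_def)
  have box_S: "cbox (Complex (- R) (- d')) (Complex R d') \<subseteq> S"
    using R \<open>d' < d\<close> by (auto simp: in_cbox_complex_iff S_def strip_def)
  have fin: "finite pts" by (simp add: pts_def J_def)
  have img: "path_image ?R \<subseteq> S - pts"
    using box_S pts_box R \<open>0 < d'\<close> by (subst path_image_rectpath_cbox_minus_box) auto
  have "contour_integral ?R ?G = 2 * pi * \<i> * (\<Sum>p\<in>pts. winding_number ?R p * residue ?G p)"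
  proof (rule Residue_theorem[OF oS convex_connected[OF cS] fin _ _ _ img])
    show "?G holomorphic_on S - pts"
      using zeros by (intro holomorphic_on_divide gS holomorphic_on_subset[OF FS]) auto
    show "\<forall>z. z \<notin> S \<longrightarrow> winding_number ?R z = 0"
      using box_S R \<open>0 < d'\<close> by (auto intro!: winding_number_rectpath_outside)
  qed auto
  also have "(\<Sum>p\<in>pts. winding_number ?R p * residue ?G p) = (\<Sum>p\<in>pts. residue ?G p)"
    by (intro sum.cong refl) (simp add: winding_number_rectpath[OF pts_box])
  also have "\<dots> = residue ?G (of_real x) + (\<Sum>j\<in>J. residue ?G (node j))"
  proof -
    have "of_real x \<notin> node ` J" using x(2) by (auto simp: node_def simp del: of_real_mult)
    moreover have "inj_on node J" using \<open>h > 0\<close> by (auto simp: inj_on_def node_def)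
    ultimately show ?thesis unfolding pts_def by (subst sum.insert) (auto simp: J_def sum.reindex)
  qed
  finally have integral_eq: "contour_integral ?R ?G =
      2 * pi * \<i> * (residue ?G (of_real x) + (\<Sum>j\<in>J. residue ?G (node j)))" .
  have residue_x: "residue ?G (of_real x) = F (of_real x) / sin (of_real (pi / h * x))"
    and residue_sum: "(\<Sum>j\<in>J. residue ?G (node j)) =
      (\<Sum>j\<in>J. F (node j) / of_real ((of_int j * h - x) * (pi / h * cos (pi * of_int j))))"
  proof -
    \<comment> \<open>Removing the other poles leaves a neighbourhood on which the denominator vanishes only at p.\<close>
    have loc: "residue ?G p = F p / g'"
      if p: "p \<in> pts" and g': "(?g has_field_derivative g') (at p)" "?g p = 0" "g' \<noteq> 0" for p g'
    proof (rule residue_at_simple_zero_of_denominator[where S = "S - (pts - {p})"])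
      show "open (S - (pts - {p}))" using fin oS by (intro open_Diff finite_imp_closed) auto
      show "p \<in> S - (pts - {p})" using p pts_box box_S box_subset_cbox by blast
      show "F holomorphic_on S - (pts - {p})" by (rule holomorphic_on_subset[OF FS]) auto
      show "?g w \<noteq> 0" if "w \<in> S - (pts - {p}) - {p}" for w using zeros that by blast
    qed (use g' gS in auto)
    have deriv: "((\<lambda>z. (z - u) * sin (c * z)) has_field_derivative
        sin (c * p) + (p - u) * (cos (c * p) * c)) (at p)" for u c p :: complex
      by (auto intro!: derivative_eq_intros)
    have sx: "sin (complex_of_real (pi / h) * of_real x) \<noteq> 0"
      using sin_scaled_eq_0_iff[OF \<open>h > 0\<close>, of "of_real x"] x(2) by (simp del: of_real_mult)
    show "residue ?G (of_real x) = F (of_real x) / sin (of_real (pi / h * x))"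
    proof (rule loc)
      show "(?g has_field_derivative sin (of_real (pi / h * x))) (at (of_real x))"
        using deriv[of "of_real x" "of_real (pi / h)" "of_real x"] by simp
    qed (use sx in \<open>auto simp: pts_def\<close>)
    show "(\<Sum>j\<in>J. residue ?G (node j)) =
      (\<Sum>j\<in>J. F (node j) / of_real ((of_int j * h - x) * (pi / h * cos (pi * of_int j))))"
    proof (rule sum.cong[OF refl], rule loc)
      fix j assume "j \<in> J"
      thus "node j \<in> pts" by (simp add: pts_def)
      have e: "of_real (pi / h) * node j = complex_of_real (pi * of_int j)"
        using \<open>h > 0\<close> by (simp add: node_def)
      have s: "sin (pi * real_of_int j) = 0" by (simp add: mult.commute[of pi] sin_times_pi_eq_0)
      have s': "sin (of_real (pi / h) * node j) = 0"
        unfolding e sin_of_real s by simp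
      thus "?g (node j) = 0" by simp
      have "(?g has_field_derivative
          sin (of_real (pi / h) * node j) + (node j - of_real x) * (cos (of_real (pi / h) * node j) * of_real (pi/h))) (at (node j))"
        by (rule deriv)
      also have "sin (of_real (pi / h) * node j) + (node j - of_real x) * (cos (of_real (pi / h) * node j) * of_real (pi/h))
         = of_real ((of_int j * h - x) * (pi / h * cos (pi * of_int j)))"
        unfolding s' unfolding e cos_of_real unfolding node_def
        by (simp only: of_real_mult of_real_diff add_0 mult_ac)
      finally show "(?g has_field_derivative
          of_real ((of_int j * h - x) * (pi / h * cos (pi * of_int j)))) (at (node j))" .
      have "cos (pi * real_of_int j) \<noteq> 0" using s sin_cos_squared_add[of "pi * real_of_int j"] by auto
      thus "complex_of_real ((of_int j * h - x) * (pi / h * cos (pi * of_int j))) \<noteq> 0"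
        unfolding of_real_eq_0_iff using x(2)[of j] \<open>h > 0\<close> by auto
    qed
  qed
  have "contour_integral ?R ?G * sin (of_real (pi / h * x)) = 2 * pi * \<i> *
     ((F (of_real x) / sin (of_real (pi / h * x)) +
       (\<Sum>j\<in>J. F (node j) / of_real ((of_int j * h - x) * (pi / h * cos (pi * of_int j)))))
        * sin (of_real (pi / h * x)))"
    unfolding integral_eq residue_x residue_sum by (simp only: mult.assoc)
  also have "(F (of_real x) / sin (of_real (pi / h * x)) +
       (\<Sum>j\<in>J. F (node j) / of_real ((of_int j * h - x) * (pi / h * cos (pi * of_int j)))))
        * sin (of_real (pi / h * x)) = F (of_real x) - (\<Sum>j\<in>J. F (node j) * of_real (Sinc j h x))"
  proof -
    have sx: "sin (complex_of_real (pi / h * x)) \<noteq> 0"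
      using sin_scaled_eq_0_iff[OF \<open>h > 0\<close>, of "of_real x"] x(2) by (simp del: of_real_mult add: of_real_mult[symmetric])
    have "F (node j) / of_real ((of_int j * h - x) * (pi / h * cos (pi * of_int j))) * sin (of_real (pi / h * x))
       = - (F (node j) * of_real (Sinc j h x))" for j
      unfolding Sinc_eq_alternating[OF \<open>h > 0\<close> x(2)] sin_of_real by simp
    thus ?thesis using sx by (simp add: distrib_right sum_distrib_right sum_negf del: of_real_mult)
  qed
  finally show ?thesis by (simp only: J_def node_def of_real_mult of_real_numeral)
qed


text \<open>
  The bound does not depend on the length of the segment, because 1/(1+x^2) has the bounded
  antiderivative arctan. This allows the rectangles to grow.
\<close>

lemma horizontal_contour_integral_bound:
  fixes f :: "complex \<Rightarrow> complex"
  assumes f: "continuous_on (closed_segment a b) f" and ab: "Im a = Im b" "Re a \<le> Re b" and "B \<ge> 0"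
    and le: "\<And>z. z \<in> closed_segment a b \<Longrightarrow> norm (f z) \<le> B / (1 + (Re z)\<^sup>2)"
  shows "norm (contour_integral (linepath a b) f) \<le> B * pi"
proof -
  define A where "A = Re a" define l where "l = Re b - Re a"
  have ba: "b - a = of_real l" using ab by (simp add: complex_eq_iff l_def)
  have seg: "linepath a b t \<in> closed_segment a b" if "t \<in> {0..1}" for t
    using that by (metis image_eqI path_image_def path_image_linepath)
  have Re_seg: "Re (linepath a b t) = A + t * l" for t
    by (simp add: linepath_def A_def l_def algebra_simps)
  have "f contour_integrable_on linepath a b" by (rule contour_integrable_continuous_linepath[OF f])
  hence int: "((\<lambda>t. f (linepath a b t) * (b - a)) has_integral contour_integral (linepath a b) f) {0..1}"
    by (simp add: has_contour_integral_integral flip: has_contour_integral_linepath)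
  have "((\<lambda>t. B * l / (1 + (A + t * l)\<^sup>2)) has_integral (B * arctan (A + 1 * l) - B * arctan (A + 0 * l))) {0..1}"
  proof (rule fundamental_theorem_of_calculus)
    fix t :: real
    have "((\<lambda>t. B * arctan (A + t * l)) has_real_derivative B * l / (1 + (A + t * l)\<^sup>2)) (at t within {0..1})"
      by (auto intro!: derivative_eq_intros simp: divide_simps)
    thus "((\<lambda>t. B * arctan (A + t * l)) has_vector_derivative B * l / (1 + (A + t * l)\<^sup>2)) (at t within {0..1})"
      by (simp add: has_real_derivative_iff_has_vector_derivative)
  qed simp
  hence g: "((\<lambda>t. B * l / (1 + (A + t * l)\<^sup>2)) has_integral (B * (arctan (A + l) - arctan A))) {0..1}"
    by (simp add: right_diff_distrib)
  have "norm (contour_integral (linepath a b) f) \<le> B * (arctan (A + l) - arctan A)"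
    unfolding integral_unique[OF int, symmetric] integral_unique[OF g, symmetric]
  proof (rule integral_norm_bound_integral)
    fix t :: real assume t: "t \<in> {0..1}"
    have "norm (f (linepath a b t) * (b - a)) = norm (f (linepath a b t)) * l"
      using ab by (simp add: ba norm_mult) (simp add: l_def)
    also have "\<dots> \<le> B / (1 + (A + t * l)\<^sup>2) * l"
      using le[OF seg[OF t]] ab by (intro mult_right_mono) (auto simp: Re_seg l_def)
    finally show "norm (f (linepath a b t) * (b - a)) \<le> B * l / (1 + (A + t * l)\<^sup>2)" by simp
  qed (use int g in auto)
  also have "\<dots> \<le> B * pi"
    using \<open>B \<ge> 0\<close> arctan_bounded[of "A + l"] arctan_bounded[of A] by (intro mult_left_mono) auto
  finally show ?thesis .
qed

text \<open>
  The first term bounds the horizontal sides, where |sin(\<pi>z/h)| \<ge> sinh(\<pi>d'/h) and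
  |z-x| \<ge> d'; the second bounds the vertical sides, where |sin(\<pi>z/h)| \<ge> 1 and
  |z-x| \<ge> h/2, and it tends to zero as the rectangle becomes wide.
\<close>

lemma rect_sinc_error:
  fixes F :: "complex \<Rightarrow> complex" and N :: nat
  assumes F: "F holomorphic_on strip d" and d': "0 < d'" "d' < d" and "h > 0"
    and K: "\<And>z. z \<in> strip d \<Longrightarrow> norm (F z) \<le> K / (1 + (Re z)\<^sup>2)"
    and x: "\<bar>x\<bar> \<le> real N * h" "\<And>j::int. x \<noteq> of_int j * h"
  defines "R \<equiv> (real N + 1/2) * h"
  shows "norm (F (of_real x) - (\<Sum>j\<in>{- int N..int N}. F (of_real (of_int j * h)) * of_real (Sinc j h x)))
    \<le> K / (d' * sinh (pi / h * d')) + 4 * K * d' / (pi * h * (1 + R\<^sup>2))"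
    (is "norm ?E \<le> _")
proof -
  define G where "G = (\<lambda>z. F z / ((z - of_real x) * sin (of_real (pi / h) * z)))"
  define a1 a2 a3 a4 where "a1 = Complex (- R) (- d')" "a2 = Complex R (- d')"
    "a3 = Complex R d'" "a4 = Complex (- R) d'"
  note a_defs = this
  have R: "R > 0" using \<open>h > 0\<close> by (simp add: R_def)
  have K0: "K \<ge> 0" using K[of 0] d' norm_ge_zero[of "F 0"] by (simp add: strip_def del: norm_ge_zero)
  have segs: "z \<in> closed_segment a1 a2 \<Longrightarrow> \<bar>Im z\<bar> = d'"
            "z \<in> closed_segment a4 a3 \<Longrightarrow> \<bar>Im z\<bar> = d'"
            "z \<in> closed_segment a2 a3 \<Longrightarrow> \<bar>Re z\<bar> = R \<and> \<bar>Im z\<bar> \<le> d'"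
            "z \<in> closed_segment a4 a1 \<Longrightarrow> \<bar>Re z\<bar> = R \<and> \<bar>Im z\<bar> \<le> d'" for z
    using R d' by (auto simp: a_defs closed_segment_same_Im closed_segment_same_Re closed_segment_eq_real_ivl)
  have sc: "Im (of_real (pi / h) * z) = pi / h * Im z" "Re (of_real (pi / h) * z) = pi / h * Re z" for z by simp_all
  define B where "B = K / (d' * sinh (pi / h * d'))"
  have sh: "sinh (pi / h * d') > 0" using d' \<open>h > 0\<close> by simp
  have B0: "B \<ge> 0" using K0 d' sh by (simp add: B_def)
  have hor: "norm (G z) \<le> B / (1 + (Re z)\<^sup>2)" "(z - of_real x) * sin (of_real (pi / h) * z) \<noteq> 0"
    if "\<bar>Im z\<bar> = d'" for z
  proof -
    have "sinh (pi / h * d') \<le> cmod (sin (of_real (pi / h) * z))"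
      using sinh_abs_le_cmod_sin[of "of_real (pi / h) * z"] that \<open>h > 0\<close>
      unfolding sc by (simp add: abs_mult)
    moreover have "d' \<le> cmod (z - of_real x)"
      using abs_Im_le_cmod[of "z - of_real x"] that by simp
    ultimately have le: "d' * sinh (pi / h * d') \<le> norm ((z - of_real x) * sin (of_real (pi / h) * z))"
      unfolding norm_mult using d' sh by (intro mult_mono) auto
    moreover have pos: "0 < d' * sinh (pi / h * d')" using d' sh by simp
    ultimately show "(z - of_real x) * sin (of_real (pi / h) * z) \<noteq> 0" by (metis norm_zero not_le)
    have "norm (G z) \<le> (K / (1 + (Re z)\<^sup>2)) / (d' * sinh (pi / h * d'))"
      unfolding G_def norm_divide using K[of z] that d' pos le
      by (intro frac_le) (auto simp: strip_def K0)
    thus "norm (G z) \<le> B / (1 + (Re z)\<^sup>2)" by (simp add: B_def mult.commute)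
  qed
  define V where "V = 2 * K / (h * (1 + R\<^sup>2))"
  have V0: "V \<ge> 0" using K0 \<open>h > 0\<close> by (simp add: V_def)
  have ver: "norm (G z) \<le> V" "(z - of_real x) * sin (of_real (pi / h) * z) \<noteq> 0"
    if "\<bar>Re z\<bar> = R" "\<bar>Im z\<bar> \<le> d'" for z
  proof -
    have "cos (pi / h * R) = 0"
    proof -
      have "pi / h * R = pi * real N + pi / 2" using \<open>h > 0\<close> by (simp add: R_def field_simps)
      thus ?thesis by (simp add: cos_add)
    qed
    hence "cos (pi / h * Re z) = 0" using that(1) by (metis abs_if cos_minus minus_mult_right)
    hence "1 \<le> cmod (sin (of_real (pi / h) * z))" by (intro cmod_sin_ge_1) (simp only: sc)
    moreover have "h / 2 \<le> cmod (z - of_real x)"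
      using abs_Re_le_cmod[of "z - of_real x"] that x(1) by (auto simp: R_def algebra_simps)
    ultimately have le: "h / 2 * 1 \<le> norm ((z - of_real x) * sin (of_real (pi / h) * z))"
      unfolding norm_mult using \<open>h > 0\<close> by (intro mult_mono) auto
    moreover have pos: "0 < h / 2 * 1" using \<open>h > 0\<close> by simp
    ultimately show "(z - of_real x) * sin (of_real (pi / h) * z) \<noteq> 0" by (metis norm_zero not_le)
    have R2: "(Re z)\<^sup>2 = R\<^sup>2" using that(1) by (metis power2_abs)
    have "norm (G z) \<le> (K / (1 + R\<^sup>2)) / (h / 2 * 1)"
      unfolding G_def norm_divide using K[of z] that d' pos le R2
      by (intro frac_le) (auto simp: strip_def K0)
    thus "norm (G z) \<le> V" by (simp add: V_def mult.commute)
  qed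
  have cont: "continuous_on A G" if "A \<subseteq> strip d" "\<And>z. z \<in> A \<Longrightarrow> (z - of_real x) * sin (of_real (pi / h) * z) \<noteq> 0" for A
    unfolding G_def using that
    by (intro continuous_intros continuous_on_subset[OF holomorphic_on_imp_continuous_on[OF F]]) auto
  have c12: "continuous_on (closed_segment a1 a2) G"
    by (rule cont) (use segs(1) d' hor(2) in \<open>force simp: strip_def\<close>)+
  have c43: "continuous_on (closed_segment a4 a3) G"
    by (rule cont) (use segs(2) d' hor(2) in \<open>force simp: strip_def\<close>)+
  have c23: "continuous_on (closed_segment a2 a3) G"
    by (rule cont) (use segs(3) d' ver(2) in \<open>force simp: strip_def\<close>)+
  have c41: "continuous_on (closed_segment a4 a1) G"
    by (rule cont) (use segs(4) d' ver(2) in \<open>force simp: strip_def\<close>)+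
  note ci = contour_integrable_continuous_linepath
  have i12: "norm (contour_integral (linepath a1 a2) G) \<le> B * pi"
    by (rule horizontal_contour_integral_bound[OF c12])
       (use R B0 segs(1) hor(1) in \<open>auto simp: a_defs\<close>)
  have i43: "norm (contour_integral (linepath a4 a3) G) \<le> B * pi"
    by (rule horizontal_contour_integral_bound[OF c43])
       (use R B0 segs(2) hor(1) in \<open>auto simp: a_defs\<close>)
  have i23: "norm (contour_integral (linepath a2 a3) G) \<le> V * norm (a3 - a2)"
    by (rule contour_integral_bound_linepath[OF ci[OF c23] V0])
       (use segs(3) ver(1) in auto)
  have i41: "norm (contour_integral (linepath a4 a1) G) \<le> V * norm (a1 - a4)"
    by (rule contour_integral_bound_linepath[OF ci[OF c41] V0])
       (use segs(4) ver(1) in auto)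
  have len: "norm (a3 - a2) = 2 * d'" "norm (a1 - a4) = 2 * d'"
  proof -
    have "a3 - a2 = Complex 0 (2 * d')" "a1 - a4 = Complex 0 (- (2 * d'))"
      by (simp_all add: a_defs complex_eq_iff)
    thus "norm (a3 - a2) = 2 * d'" "norm (a1 - a4) = 2 * d'"
      using d' by (simp_all add: complex_norm real_sqrt_mult)
  qed
  have c34: "continuous_on (closed_segment a3 a4) G" using c43 by (simp add: closed_segment_commute)
  have split: "contour_integral (rectpath a1 a3) G = contour_integral (linepath a1 a2) G +
      contour_integral (linepath a2 a3) G - contour_integral (linepath a4 a3) G + contour_integral (linepath a4 a1) G"
  proof -
    have "rectpath a1 a3 = linepath a1 a2 +++ linepath a2 a3 +++ linepath a3 a4 +++ linepath a4 a1"
      by (simp add: rectpath_def a_defs Let_def)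
    thus ?thesis using ci[OF c12] ci[OF c23] ci[OF c34] ci[OF c41] contour_integral_reverse_linepath[OF c34]
      by simp
  qed
  have integral_le: "norm (contour_integral (rectpath a1 a3) G) \<le> B * pi + V * (2 * d') + B * pi + V * (2 * d')"
    unfolding split using i12 i23 i43 i41 unfolding len
    by (smt (verit) norm_triangle_ineq norm_triangle_ineq4)
  have integral_eq: "contour_integral (rectpath a1 a3) G * sin (of_real (pi / h * x)) = 2 * of_real pi * \<i> * ?E"
    unfolding a_defs G_def R_def by (rule rect_contour_integral_sinc[OF F d' \<open>h > 0\<close> x])
  have sin_le: "norm (sin (complex_of_real (pi / h * x))) \<le> 1"
    unfolding sin_of_real by simp
  have "norm (2 * of_real pi * \<i> * ?E) \<le> (B * pi + V * (2 * d') + B * pi + V * (2 * d')) * 1"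
    unfolding integral_eq[symmetric] norm_mult[of "contour_integral _ _"]
    using order_trans[OF norm_ge_zero integral_le]
    by (intro mult_mono integral_le sin_le norm_ge_zero)
  moreover have "norm (2 * of_real pi * \<i> * ?E) = 2 * pi * norm ?E"
    unfolding norm_mult by simp
  moreover have "(B * pi + V * (2 * d') + B * pi + V * (2 * d')) * 1 = 2 * pi * (B + 2 * V * d' / pi)"
    by (simp add: field_simps)
  ultimately have "2 * pi * norm ?E \<le> 2 * pi * (B + 2 * V * d' / pi)" by simp
  hence "norm ?E \<le> B + 2 * V * d' / pi" by simp
  also have "2 * V * d' / pi = 4 * K * d' / (pi * h * (1 + R\<^sup>2))" by (simp add: V_def mult_ac)
  finally show ?thesis by (simp only: B_def)
qed

text \<open>
  The rectangles need d' < d, since F need not extend to the boundary of the strip, and they need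
  to be wide, whereas the sum stops at n. Both are removed by limits: the terms with n < |j| \<le> N
  cost at most T whatever N is, so first N \<rightarrow> \<infinity> and then d' \<rightarrow> d.
\<close>

lemma truncated_cardinal_series_error:
  fixes F :: "complex \<Rightarrow> complex" and n :: nat
  assumes F: "F holomorphic_on strip d" and "d > 0" "h > 0"
    and K: "\<And>z. z \<in> strip d \<Longrightarrow> norm (F z) \<le> K / (1 + (Re z)\<^sup>2)"
    and T: "\<And>N::nat. (\<Sum>j\<in>{- int N..int N} - {- int n..int n}. norm (F (of_real (of_int j * h)))) \<le> T"
  shows "norm (F (of_real x) - (\<Sum>j\<in>{- int n..int n}. F (of_real (of_int j * h)) * of_real (Sinc j h x)))
    \<le> K / (d * sinh (pi / h * d)) + T"
proof -
  define t where "t = (\<lambda>j::int. F (of_real (of_int j * h)) * of_real (Sinc j h x))"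
  define E where "E = (\<lambda>N::nat. F (of_real x) - (\<Sum>j\<in>{- int N..int N}. t j))"
  have K0: "K \<ge> 0" using K[of 0] \<open>d > 0\<close> norm_ge_zero[of "F 0"] by (simp add: strip_def del: norm_ge_zero)
  have tail: "norm (E n) \<le> norm (E N) + T" if "n \<le> N" for N
  proof -
    have "E n = E N + (\<Sum>j\<in>{- int N..int N} - {- int n..int n}. t j)"
      using that by (simp add: E_def sum_diff)
    also have "norm \<dots> \<le> norm (E N) + (\<Sum>j\<in>{- int N..int N} - {- int n..int n}. norm (t j))"
      by (intro order_trans[OF norm_triangle_ineq] add_left_mono norm_sum)
    also have "(\<Sum>j\<in>{- int N..int N} - {- int n..int n}. norm (t j))
        \<le> (\<Sum>j\<in>{- int N..int N} - {- int n..int n}. norm (F (of_real (of_int j * h))))"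
      using Sinc_abs_le_1[OF \<open>h > 0\<close>]
      by (intro sum_mono) (auto simp: t_def norm_mult intro: mult_left_le)
    also have "\<dots> \<le> T" by (rule T)
    finally show ?thesis by simp
  qed
  have "norm (E n) \<le> K / (d * sinh (pi / h * d)) + T"
  \<comment> \<open>At a node two poles of the kernel merge and the contour integral is of no use, but there
    the series reproduces F exactly.\<close>
  proof (cases "\<exists>k::int. x = of_int k * h")
    case True
    then obtain k :: int where k: "x = of_int k * h" by blast
    define N where "N = max n (nat \<bar>k\<bar>)"
    have "(\<Sum>j\<in>{- int N..int N}. t j) = (\<Sum>j\<in>{- int N..int N}. if j = k then F (of_real x) else 0)"
      using \<open>h > 0\<close> by (intro sum.cong) (auto simp: t_def k Sinc_node)
    also have "\<dots> = F (of_real x)" by (subst sum.delta) (auto simp: N_def)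
    finally have "E N = 0" by (simp add: E_def)
    moreover have "0 \<le> K / (d * sinh (pi / h * d))" using K0 \<open>d > 0\<close> \<open>h > 0\<close> by simp
    ultimately show ?thesis using tail[of N] by (simp add: N_def)
  next
    case False
    have bound: "norm (E n) \<le> K / (d' * sinh (pi / h * d')) + T" if d': "d' \<in> {0<..<d}" for d'
    proof (rule tendsto_lowerbound)
      have "filterlim (\<lambda>N. (real N + 1/2) * h) at_top sequentially"
        using \<open>h > 0\<close> by real_asymp
      hence "filterlim (\<lambda>N. 1 + ((real N + 1/2) * h)\<^sup>2) at_top sequentially"
        using \<open>h > 0\<close> by real_asymp
      hence "filterlim (\<lambda>N. pi * h * (1 + ((real N + 1/2) * h)\<^sup>2)) at_top sequentially"
        using \<open>h > 0\<close> by (intro filterlim_tendsto_pos_mult_at_top[OF tendsto_const]) auto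
      hence "(\<lambda>N. 4 * K * d' / (pi * h * (1 + ((real N + 1/2) * h)\<^sup>2))) \<longlonglongrightarrow> 0"
        by (intro real_tendsto_divide_at_top[OF tendsto_const])
      from tendsto_add[OF tendsto_add[OF tendsto_const this] tendsto_const]
      show "(\<lambda>N. K / (d' * sinh (pi / h * d')) + 4 * K * d' / (pi * h * (1 + ((real N + 1/2) * h)\<^sup>2)) + T)
          \<longlonglongrightarrow> K / (d' * sinh (pi / h * d')) + T" by simp
      have "norm (E n) \<le> K / (d' * sinh (pi / h * d')) + 4 * K * d' / (pi * h * (1 + ((real N + 1/2) * h)\<^sup>2)) + T"
        if "N \<ge> max n (nat \<lceil>\<bar>x\<bar> / h\<rceil>)" for N
      proof -
        have "\<bar>x\<bar> / h \<le> real N" using that by linarith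
        hence "\<bar>x\<bar> \<le> real N * h" using \<open>h > 0\<close> by (simp add: field_simps)
        hence "norm (E N) \<le> K / (d' * sinh (pi / h * d')) + 4 * K * d' / (pi * h * (1 + ((real N + 1/2) * h)\<^sup>2))"
          unfolding E_def t_def using False d' K
          by (intro rect_sinc_error[OF F _ _ \<open>h > 0\<close>]) auto
        thus ?thesis using tail[of N] that by simp
      qed
      thus "\<forall>\<^sub>F N in sequentially. norm (E n) \<le> K / (d' * sinh (pi / h * d')) + 4 * K * d' / (pi * h * (1 + ((real N + 1/2) * h)\<^sup>2)) + T"
        unfolding eventually_sequentially by blast
    qed simp
    show ?thesis
    proof (rule tendsto_lowerbound)
      have "d * sinh (pi / h * d) \<noteq> 0" using \<open>d > 0\<close> \<open>h > 0\<close> by simp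
      thus "((\<lambda>d'. K / (d' * sinh (pi / h * d')) + T) \<longlongrightarrow> K / (d * sinh (pi / h * d)) + T) (at_left d)"
        by (intro tendsto_intros)
      show "\<forall>\<^sub>F d' in at_left d. norm (E n) \<le> K / (d' * sinh (pi / h * d')) + T"
        using eventually_at_left_real[OF \<open>d > 0\<close>] by eventually_elim (rule bound)
    qed simp
  qed
  thus ?thesis by (simp only: E_def t_def)
qed

section \<open>Decay of the double exponential map\<close>

lemma norm_exp_pi_sinh: "norm (exp (of_real pi * sinh z)) = exp (pi * (sinh (Re z) * cos (Im z)))"
proof -
  have "Re (sinh z) = sinh (Re z) * cos (Im z)"
    by (simp add: sinh_def Re_exp algebra_simps)
  thus ?thesis by simp
qed

lemma norm_cosh_le: "norm (cosh z) \<le> cosh (Re z)" for z :: complex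
proof -
  have "norm (exp z + exp (- z)) \<le> exp (Re z) + exp (- Re z)"
    using norm_triangle_ineq[of "exp z" "exp (- z)"] by simp
  thus ?thesis by (simp add: cosh_def)
qed

lemma DE_phi_holomorphic: "DE_phi holomorphic_on strip (pi/2)"
  and exp_DE_phi: "z \<in> strip (pi/2) \<Longrightarrow> exp (DE_phi z) = 1 + exp (of_real pi * sinh z)"
  using DE_phi_spec by (auto simp: is_DE_map_def)

lemma DE_phi_has_field_derivative:
  assumes z: "z \<in> strip (pi/2)"
  shows "(DE_phi has_field_derivative
    of_real pi * cosh z * (exp (of_real pi * sinh z) / (1 + exp (of_real pi * sinh z)))) (at z)"
proof -
  let ?E = "\<lambda>z. exp (of_real pi * sinh z) :: complex"
  have d: "(DE_phi has_field_derivative deriv DE_phi z) (at z)"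
    using DE_phi_holomorphic strip_open z by (rule holomorphic_derivI)
  hence "((\<lambda>z. exp (DE_phi z)) has_field_derivative exp (DE_phi z) * deriv DE_phi z) (at z)"
    by (auto intro!: derivative_eq_intros)
  moreover have "((\<lambda>z. 1 + ?E z) has_field_derivative ?E z * (of_real pi * cosh z)) (at z)"
    by (auto intro!: derivative_eq_intros)
  hence "((\<lambda>z. exp (DE_phi z)) has_field_derivative ?E z * (of_real pi * cosh z)) (at z)"
    by (rule has_field_derivative_transform_within_open[OF _ strip_open z]) (simp add: exp_DE_phi)
  ultimately have "(1 + ?E z) * deriv DE_phi z = ?E z * (of_real pi * cosh z)"
    unfolding exp_DE_phi[OF z] by (rule DERIV_unique)
  hence "deriv DE_phi z = ?E z * (of_real pi * cosh z) / (1 + ?E z)"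
    by (metis nonzero_mult_div_cancel_left one_plus_exp_pi_sinh_nonzero[OF z])
  hence "deriv DE_phi z = of_real pi * cosh z * (?E z / (1 + ?E z))"
    by (simp only: times_divide_eq_right mult.commute)
  thus ?thesis using d by simp
qed

text \<open>
  The branch of the logarithm is known explicitly only on the real line. Its size off the line is
  obtained by integrating the derivative along the vertical segment from the real axis; there
  |\<phi>'| is at most \<pi> cosh(Re z) times the quotient bounded by r.
\<close>

lemma norm_DE_phi_vertical:
  assumes z: "z \<in> strip (pi/2)"
    and r: "\<And>w. Re w = Re z \<Longrightarrow> \<bar>Im w\<bar> \<le> \<bar>Im z\<bar> \<Longrightarrow>
      norm (exp (of_real pi * sinh w) / (1 + exp (of_real pi * sinh w))) \<le> r"
  shows "norm (DE_phi z) \<le> ln (1 + exp (pi * sinh (Re z))) + pi * cosh (Re z) * r * \<bar>Im z\<bar>"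
proof -
  let ?D = "\<lambda>w. of_real pi * cosh w * (exp (of_real pi * sinh w) / (1 + exp (of_real pi * sinh w)))"
  define L where "L = closed_segment (of_real (Re z)) z"
  have L: "Re w = Re z \<and> \<bar>Im w\<bar> \<le> \<bar>Im z\<bar>" if "w \<in> L" for w
    using that unfolding L_def by (auto simp: closed_segment_same_Re closed_segment_eq_real_ivl split: if_splits)
  have "norm (DE_phi z - DE_phi (of_real (Re z))) \<le> pi * cosh (Re z) * r * norm (z - of_real (Re z))"
  proof (rule field_differentiable_bound)
    show "convex L" by (simp add: L_def)
    show "(DE_phi has_field_derivative ?D w) (at w within L)" if "w \<in> L" for w
    proof (rule has_field_derivative_at_within, rule DE_phi_has_field_derivative)
      show "w \<in> strip (pi/2)" using L[OF that] z by (simp add: strip_def)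
    qed
    show "norm (?D w) \<le> pi * cosh (Re z) * r" if "w \<in> L" for w
    proof -
      have "norm (of_real pi * cosh w) \<le> pi * cosh (Re z)"
        using norm_cosh_le[of w] L[OF that] by (simp add: norm_mult)
      thus ?thesis using r[of w] L[OF that]
        by (subst norm_mult) (intro mult_mono, auto)
    qed
  qed (auto simp: L_def)
  moreover have "norm (z - of_real (Re z)) = \<bar>Im z\<bar>" by (simp add: cmod_def)
  moreover have "norm (DE_phi (of_real (Re z))) = ln (1 + exp (pi * sinh (Re z)))"
    unfolding DE_phi_of_real by simp
  moreover have "norm (DE_phi z) \<le> norm (DE_phi (of_real (Re z))) + norm (DE_phi z - DE_phi (of_real (Re z)))"
    by (rule norm_triangle_sub)
  ultimately show ?thesis by simp
qed

text \<open>
  Put w = \<pi> sinh z and s = |sinh(Re z)|; in the strip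
  |Re w| \<ge> \<pi>s cos d. To the right, |1+e^w| is of the size of |e^w|: the factor
  e^{-\<phi>} = 1/(1+e^w) decays like e^{-\<pi>s cos d}, while \<phi> grows like cosh(Re z).
  To the left the roles are exchanged: 1+e^w stays away from zero and \<phi> = log(1+e^w) itself
  decays like e^{-\<pi>s cos d}, again up to a factor cosh(Re z). The hypothesis, which says
  e^{\<pi>s cos d} \<ge> 2, keeps 1+e^w away from zero in both cases.
\<close>

lemma DE_phi_exp_bound_far:
  assumes "0 < d" "d < pi/2" and z: "z \<in> strip d"
    and far: "ln 2 \<le> pi * cos d * \<bar>sinh (Re z)\<bar>"
  shows "norm (DE_phi z) * norm (exp (- DE_phi z))
    \<le> 2 * (1 + pi + pi\<^sup>2) * cosh (Re z) * exp (- (pi * cos d * \<bar>sinh (Re z)\<bar>))"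
proof -
  define s where "s = \<bar>sinh (Re z)\<bar>"
  define b where "b = pi * cos d"
  define c where "c = cosh (Re z)"
  let ?E = "\<lambda>w. exp (of_real pi * sinh w) :: complex"
  have z': "z \<in> strip (pi/2)" using z assms by (simp add: strip_def)
  have c: "1 \<le> c" by (simp add: c_def cosh_real_ge_1)
  have sc: "s \<le> c" unfolding s_def c_def
    using sinh_le_cosh_real[of "\<bar>Re z\<bar>"] by (cases "Re z \<ge> 0") auto
  have cos_ge: "cos d \<le> cos (Im w)" if "\<bar>Im w\<bar> \<le> \<bar>Im z\<bar>" for w
  proof -
    have "cos d \<le> cos \<bar>Im w\<bar>" using that z assms by (intro cos_monotone_0_pi_le) (auto simp: strip_def)
    thus ?thesis by simp
  qed
  have "exp (ln 2) \<le> exp (b * s)" using far by (simp only: b_def s_def exp_le_cancel_iff)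
  hence e2: "2 \<le> exp (b * s)" by simp
  have norm_exp: "norm (exp (- DE_phi z)) = 1 / norm (1 + ?E z)"
    unfolding exp_minus exp_DE_phi[OF z'] by (simp add: norm_inverse divide_inverse)
  show ?thesis
  proof (cases "Re z \<ge> 0")
    case True
    have large: "exp (b * s) \<le> norm (?E w)" if "Re w = Re z" "\<bar>Im w\<bar> \<le> \<bar>Im z\<bar>" for w
      unfolding norm_exp_pi_sinh using True that cos_ge[OF that(2)]
      by (simp add: b_def s_def mult.assoc mult.commute[of "cos d"] mult_left_mono)
    have half: "norm (?E w) / 2 \<le> norm (1 + ?E w)" if "Re w = Re z" "\<bar>Im w\<bar> \<le> \<bar>Im z\<bar>" for w
    proof -
      have "norm (?E w) \<le> norm (1 + ?E w) + 1"
        using norm_triangle_ineq4[of "1 + ?E w" 1] by simp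
      thus ?thesis using large[OF that] e2 by linarith
    qed
    have "norm (DE_phi z) \<le> ln (1 + exp (pi * sinh (Re z))) + pi * cosh (Re z) * 2 * \<bar>Im z\<bar>"
    proof (rule norm_DE_phi_vertical[OF z'])
      fix w assume w: "Re w = Re z" "\<bar>Im w\<bar> \<le> \<bar>Im z\<bar>"
      have "0 < norm (1 + ?E w)" using half[OF w] large[OF w] e2 by linarith
      thus "norm (?E w / (1 + ?E w)) \<le> 2" using half[OF w] by (simp add: norm_divide field_simps)
    qed
    moreover have "ln (1 + exp (pi * sinh (Re z))) \<le> c + pi * c"
    proof -
      have "1 + exp (pi * s) \<le> exp 1 * exp (pi * s)"
      proof -
        have "1 \<le> exp (pi * s)" by (simp add: s_def)
        moreover have "2 * exp (pi * s) \<le> exp 1 * exp (pi * s)"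
          using exp_ge_add_one_self[of 1] by (intro mult_right_mono) auto
        ultimately show ?thesis by linarith
      qed
      hence "ln (1 + exp (pi * s)) \<le> ln (exp (1 + pi * s))"
        by (subst ln_le_cancel_iff) (auto simp: exp_add add_pos_pos)
      also have "\<dots> \<le> c + pi * c" using c sc by (auto intro!: add_mono mult_left_mono)
      finally show ?thesis using True by (simp add: s_def)
    qed
    moreover have "pi * cosh (Re z) * 2 * \<bar>Im z\<bar> \<le> pi\<^sup>2 * c"
    proof -
      have "pi * c * (2 * \<bar>Im z\<bar>) \<le> pi * c * pi"
        using z' c by (intro mult_left_mono) (auto simp: strip_def)
      thus ?thesis by (simp add: power2_eq_square c_def mult_ac)
    qed
    ultimately have "norm (DE_phi z) \<le> (1 + pi + pi\<^sup>2) * c" by (simp add: algebra_simps)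
    moreover have "norm (exp (- DE_phi z)) \<le> 2 * exp (- (b * s))"
    proof -
      have "exp (b * s) / 2 \<le> norm (1 + ?E z)" using half[OF refl order_refl] large[OF refl order_refl] by linarith
      hence "1 / norm (1 + ?E z) \<le> 1 / (exp (b * s) / 2)" by (intro frac_le) auto
      moreover have "1 / (exp (b * s) / 2) = 2 * exp (- (b * s))" by (simp add: exp_minus inverse_eq_divide)
      ultimately show ?thesis unfolding norm_exp by linarith
    qed
    ultimately have "norm (DE_phi z) * norm (exp (- DE_phi z)) \<le> ((1 + pi + pi\<^sup>2) * c) * (2 * exp (- (b * s)))"
      using c by (intro mult_mono) (auto intro!: mult_nonneg_nonneg add_nonneg_nonneg)
    thus ?thesis by (simp only: c_def b_def s_def mult_ac)
  next
    case False
    have sh: "sinh (Re z) = - s" using False by (simp add: s_def)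
    have s0: "0 \<le> s" by (simp add: s_def)
    have small: "norm (?E w) \<le> exp (- (b * s))" if "Re w = Re z" "\<bar>Im w\<bar> \<le> \<bar>Im z\<bar>" for w
    proof -
      have "pi * (s * cos d) \<le> pi * (s * cos (Im w))"
        using cos_ge[OF that(2)] s0 by (intro mult_left_mono) auto
      moreover have "pi * (sinh (Re w) * cos (Im w)) = - (pi * (s * cos (Im w)))"
        unfolding that(1) sh by simp
      moreover have "b * s = pi * (s * cos d)" by (simp add: b_def)
      ultimately show ?thesis unfolding norm_exp_pi_sinh exp_le_cancel_iff by linarith
    qed
    have e2': "exp (- (b * s)) \<le> 1 / 2"
      using e2 by (simp add: exp_minus field_simps)
    have half: "1 / 2 \<le> norm (1 + ?E w)" if "Re w = Re z" "\<bar>Im w\<bar> \<le> \<bar>Im z\<bar>" for w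
      using norm_triangle_ineq4[of "1 + ?E w" "?E w"] small[OF that] e2'
      unfolding add_diff_cancel_right' norm_one by linarith
    have "norm (DE_phi z) \<le> ln (1 + exp (pi * sinh (Re z))) + pi * cosh (Re z) * (2 * exp (- (b * s))) * \<bar>Im z\<bar>"
    proof (rule norm_DE_phi_vertical[OF z'])
      fix w assume w: "Re w = Re z" "\<bar>Im w\<bar> \<le> \<bar>Im z\<bar>"
      have "norm (?E w / (1 + ?E w)) \<le> exp (- (b * s)) / (1 / 2)"
        unfolding norm_divide using half[OF w] small[OF w] by (intro frac_le) auto
      thus "norm (?E w / (1 + ?E w)) \<le> 2 * exp (- (b * s))" by simp
    qed
    moreover have "ln (1 + exp (pi * sinh (Re z))) \<le> c * exp (- (b * s))"
    proof -
      have "ln (1 + exp (pi * sinh (Re z))) \<le> exp (pi * sinh (Re z))"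
        by (rule ln_add_one_self_le_self) simp
      also have "\<dots> \<le> 1 * exp (- (b * s))"
      proof -
        have "cos d * s \<le> 1 * s" using s0 by (intro mult_right_mono) auto
        hence "b * s \<le> pi * s" by (simp add: b_def)
        thus ?thesis by (simp add: sh)
      qed
      also have "\<dots> \<le> c * exp (- (b * s))" using c by (intro mult_right_mono) auto
      finally show ?thesis .
    qed
    moreover have "pi * cosh (Re z) * (2 * exp (- (b * s))) * \<bar>Im z\<bar> \<le> pi\<^sup>2 * c * exp (- (b * s))"
    proof -
      have "pi * c * exp (- (b * s)) * (2 * \<bar>Im z\<bar>) \<le> pi * c * exp (- (b * s)) * pi"
        using z' c by (intro mult_left_mono) (auto simp: strip_def)
      thus ?thesis by (simp add: power2_eq_square c_def mult_ac)
    qed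
    moreover have "0 \<le> pi * c * exp (- (b * s))" using c by simp
    ultimately have "norm (DE_phi z) \<le> (1 + pi + pi\<^sup>2) * c * exp (- (b * s))"
      unfolding distrib_right mult_1_left by linarith
    moreover have "norm (exp (- DE_phi z)) \<le> 2"
    proof -
      have "1 / norm (1 + ?E z) \<le> 1 / (1 / 2)" using half[OF refl order_refl] by (intro frac_le) auto
      also have "\<dots> = 2" by simp
      finally show ?thesis unfolding norm_exp .
    qed
    ultimately have "norm (DE_phi z) * norm (exp (- DE_phi z)) \<le> ((1 + pi + pi\<^sup>2) * c * exp (- (b * s))) * 2"
      using c by (intro mult_mono) (auto intro!: mult_nonneg_nonneg add_nonneg_nonneg)
    thus ?thesis by (simp only: c_def b_def s_def mult_ac)
  qed
qed

text \<open>
  The remaining central part of the strip is relatively compact in the larger strip on which \<phi> is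
  holomorphic, so the product is bounded there. Half of the exponential decay is given up to absorb the
  factor cosh(Re z).
\<close>

lemma DE_phi_exp_bound:
  assumes "0 < d" "d < pi/2"
  obtains K where "K > 0" "\<And>z. z \<in> strip d \<Longrightarrow>
    norm (DE_phi z) * norm (exp (- DE_phi z)) \<le> K * exp (- (pi * cos d / 2 * \<bar>sinh (Re z)\<bar>))"
proof -
  define b where "b = pi * cos d"
  have b: "b > 0" using cos_gt_zero_pi[of d] assms by (simp add: b_def)
  \<comment> \<open>The part not covered by the estimate for large real parts lies between -X and X.\<close>
  define X where "X = arsinh (ln 2 / b)"
  define Q where "Q = cbox (Complex (- X) (- d)) (Complex X d)"
  have "Q \<subseteq> strip (pi/2)" using assms by (auto simp: Q_def strip_def in_cbox_complex_iff)
  hence "continuous_on Q (\<lambda>z. norm (DE_phi z) * norm (exp (- DE_phi z)))"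
    by (intro continuous_intros continuous_on_subset[OF holomorphic_on_imp_continuous_on[OF DE_phi_holomorphic]])
  hence "bounded ((\<lambda>z. norm (DE_phi z) * norm (exp (- DE_phi z))) ` Q)"
    by (intro compact_imp_bounded compact_continuous_image) (auto simp: Q_def)
  then obtain M where M: "M > 0" "\<And>z. z \<in> Q \<Longrightarrow> norm (DE_phi z) * norm (exp (- DE_phi z)) \<le> M"
    unfolding bounded_pos by (force simp: norm_mult)
  \<comment> \<open>The factor 2 in front of M is due to the exponential, which is at least 1/2 on the central part.\<close>
  define K where "K = max (2 * M) (2 * (1 + pi + pi\<^sup>2) * (1 + 2 / b))"
  have "norm (DE_phi z) * norm (exp (- DE_phi z)) \<le> K * exp (- (b / 2 * \<bar>sinh (Re z)\<bar>))"
    if z: "z \<in> strip d" for z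
  proof (cases "ln 2 \<le> b * \<bar>sinh (Re z)\<bar>")
    case True
    define s where "s = \<bar>sinh (Re z)\<bar>"
    have cosh_le: "cosh (Re z) \<le> 1 + s"
    proof (rule power2_le_imp_le)
      have "s\<^sup>2 = (sinh (Re z))\<^sup>2" "0 \<le> s" by (simp_all add: s_def)
      thus "(cosh (Re z))\<^sup>2 \<le> (1 + s)\<^sup>2" by (simp add: cosh_square_eq power2_sum)
    qed (simp add: s_def)
    also have "\<dots> \<le> (1 + 2 / b) * (1 + b / 2 * s)"
      using b by (simp add: s_def field_simps)
    also have "\<dots> \<le> (1 + 2 / b) * exp (b / 2 * s)"
      using b by (intro mult_left_mono exp_ge_add_one_self) auto
    finally have ch: "cosh (Re z) \<le> (1 + 2 / b) * exp (b / 2 * s)" .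
    have "norm (DE_phi z) * norm (exp (- DE_phi z)) \<le> 2 * (1 + pi + pi\<^sup>2) * cosh (Re z) * exp (- (b * s))"
      using DE_phi_exp_bound_far[OF assms z] True by (simp add: b_def s_def)
    also have "\<dots> \<le> 2 * (1 + pi + pi\<^sup>2) * ((1 + 2 / b) * exp (b / 2 * s)) * exp (- (b * s))"
      by (intro mult_right_mono mult_left_mono ch) (auto intro!: add_nonneg_nonneg)
    also have "\<dots> = 2 * (1 + pi + pi\<^sup>2) * (1 + 2 / b) * (exp (b / 2 * s) * exp (- (b * s)))"
      by (simp only: mult.assoc)
    also have "exp (b / 2 * s) * exp (- (b * s)) = exp (- (b / 2 * s))"
      unfolding exp_add[symmetric] by simp
    also have "2 * (1 + pi + pi\<^sup>2) * (1 + 2 / b) * exp (- (b / 2 * s)) \<le> K * exp (- (b / 2 * s))"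
      by (intro mult_right_mono) (auto simp: K_def)
    finally show ?thesis by (simp only: s_def)
  next
    case False
    have "\<bar>sinh (Re z)\<bar> < sinh X" using False b by (simp add: X_def field_simps)
    hence "sinh (Re z) < sinh X" "sinh (- X) < sinh (Re z)" by (auto simp: abs_less_iff)
    hence "Re z < X" "- X < Re z" by (simp_all only: sinh_real_less_iff)
    hence "z \<in> Q" using z by (auto simp: Q_def in_cbox_complex_iff strip_def)
    have "norm (DE_phi z) * norm (exp (- DE_phi z)) \<le> (2 * M) * (1 / 2)" using M(2)[OF \<open>z \<in> Q\<close>] by simp
    also have "\<dots> \<le> K * exp (- (b / 2 * \<bar>sinh (Re z)\<bar>))"
    proof (intro mult_mono)
      have "1 / 2 = exp (- ln 2 :: real)" by (simp add: exp_minus)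
      also have "\<dots> \<le> exp (- (b / 2 * \<bar>sinh (Re z)\<bar>))"
      proof -
        have "b / 2 * \<bar>sinh (Re z)\<bar> \<le> b * \<bar>sinh (Re z)\<bar>" using b by (intro mult_right_mono) auto
        thus ?thesis using False by simp
      qed
      finally show "1 / 2 \<le> exp (- (b / 2 * \<bar>sinh (Re z)\<bar>))" .
    qed (use M in \<open>auto simp: K_def\<close>)
    finally show ?thesis .
  qed
  moreover have "K > 0" using M by (simp add: K_def)
  ultimately show ?thesis using that by (simp only: b_def)
qed

section \<open>Elementary estimates for double exponential sums and the step size\<close>

text \<open>
  The contour integrals only need integrable decay; here the double exponential decay is weakened to
  the form in which the arctangent can be used.
\<close>

lemma exp_minus_sinh_le_inverse_quadratic:
  fixes a x :: real
  assumes "a > 0"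
  shows "exp (- (a * \<bar>sinh x\<bar>)) \<le> (1 + 2 / a\<^sup>2) / (1 + x\<^sup>2)"
proof -
  define s where "s = \<bar>sinh x\<bar>"
  have "\<bar>x\<bar> \<le> s" using real_le_abs_sinh[of x] by (simp add: s_def sinh_def exp_minus)
  hence "x\<^sup>2 \<le> s\<^sup>2" by (simp add: s_def abs_le_square_iff)
  hence "1 + x\<^sup>2 \<le> 1 + s\<^sup>2" by simp
  also have "\<dots> \<le> (1 + 2 / a\<^sup>2) * (1 + (a * s)\<^sup>2 / 2)"
    using assms by (simp add: field_simps)
  also have "\<dots> \<le> (1 + 2 / a\<^sup>2) * exp (a * s)"
  proof (rule mult_left_mono)
    have "0 \<le> a * s" using assms by (simp add: s_def)
    from exp_lower_Taylor_quadratic[OF this] this show "1 + (a * s)\<^sup>2 / 2 \<le> exp (a * s)" by linarith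
  qed simp
  finally have "exp (- (a * s)) * (1 + x\<^sup>2) \<le> exp (- (a * s)) * ((1 + 2 / a\<^sup>2) * exp (a * s))"
    by (rule mult_left_mono) simp
  also have "\<dots> = 1 + 2 / a\<^sup>2" by (simp add: exp_minus)
  finally have "exp (- (a * s)) * (1 + x\<^sup>2) \<le> 1 + 2 / a\<^sup>2" .
  moreover have "0 < 1 + x\<^sup>2" by (simp add: add_pos_nonneg)
  ultimately show ?thesis by (simp only: s_def pos_le_divide_eq)
qed

lemma arsinh_le_self:
  fixes x :: real
  assumes "0 \<le> x"
  shows "arsinh x \<le> x"
proof -
  have "0 \<le> arsinh x" using assms arsinh_real_neg_iff[of x] by linarith
  hence "arsinh x \<le> sinh (arsinh x)"
    using real_le_x_sinh[of "arsinh x"] unfolding sinh_def exp_minus by simp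
  thus ?thesis by simp
qed

lemma mono_arsinh: "x \<le> y \<Longrightarrow> arsinh x \<le> arsinh (y::real)"
  using arsinh_less_iff_real[of y x] by linarith

text \<open>
  Since arsinh is unbounded, n/arsinh(cn) = o(n). Hence any rate
  e^{-\<kappa> n}, however small \<kappa> > 0, beats e^{-bn/arsinh(cn)} up to a
  constant factor.
\<close>

lemma linear_over_arsinh_le:
  fixes b c \<kappa> :: real
  assumes "b > 0" "c > 0" "\<kappa> > 0"
  obtains B where "\<And>n::nat. n > 0 \<Longrightarrow> b * real n / arsinh (c * real n) \<le> \<kappa> * real n + B"
proof -
  obtain X where X: "\<And>x. x \<ge> X \<Longrightarrow> b / \<kappa> \<le> arsinh x"
    using arsinh_real_at_top unfolding filterlim_at_top eventually_at_top_linorder by meson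
  define M where "M = max 0 (X / c)"
  have c_pos: "0 < arsinh c" using assms by simp
  have "b * real n / arsinh (c * real n) \<le> \<kappa> * real n + b * M / arsinh c" if "n > 0" for n :: nat
  proof (cases "X \<le> c * real n")
    case True
    have "b / \<kappa> > 0" using assms by simp
    hence A: "arsinh (c * real n) > 0" using X[OF True] by linarith
    have "b \<le> \<kappa> * arsinh (c * real n)" using X[OF True] assms by (simp add: field_simps)
    hence "b * real n \<le> \<kappa> * arsinh (c * real n) * real n" by (rule mult_right_mono) simp
    hence "b * real n / arsinh (c * real n) \<le> \<kappa> * real n" using A by (simp add: field_simps)
    moreover have "0 \<le> b * M / arsinh c" using assms c_pos by (simp add: M_def divide_nonneg_pos)
    ultimately show ?thesis by linarith
  next
    case False
    have "real n \<le> X / c" using False assms by (simp add: field_simps)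
    hence "real n \<le> M" by (simp add: M_def)
    moreover have "arsinh c \<le> arsinh (c * real n)"
      using assms that by (intro mono_arsinh) simp
    ultimately have "b * real n / arsinh (c * real n) \<le> b * M / arsinh c"
      using assms c_pos by (intro frac_le mult_left_mono mult_nonneg_nonneg) (auto simp: M_def)
    moreover have "0 \<le> \<kappa> * real n" using assms by simp
    ultimately show ?thesis by linarith
  qed
  thus ?thesis by (rule that)
qed

text \<open>
  Superadditivity of sinh on the positive axis gives sinh((n+k)h) \<ge> sinh(nh) + kh, so the tail
  is dominated by e^{-a sinh(nh)} times a geometric series of ratio e^{-ah}, whose sum is at most
  1/(ah).
\<close>

lemma sum_double_exponential_tail:
  fixes a h :: real
  assumes "a > 0" "h > 0"
  shows "(\<Sum>j\<in>{- int N..int N} - {- int n..int n}. exp (- (a * \<bar>sinh (of_int j * h)\<bar>)))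
    \<le> 2 * exp (- (a * sinh (real n * h))) / (a * h)"
proof -
  let ?e = "\<lambda>j::int. exp (- (a * \<bar>sinh (of_int j * h)\<bar>))"
  \<comment> \<open>The indices beyond n in absolute value are I k and - I k.\<close>
  define I where "I = (\<lambda>k::nat. int n + 1 + int k)"
  define q where "q = exp (- (a * h))"
  have q: "0 < q" "q < 1" using assms by (auto simp: q_def)
  have "{- int N..int N} - {- int n..int n} \<subseteq> I ` {..<N} \<union> (\<lambda>k. - I k) ` {..<N}"
  proof
    fix j assume "j \<in> {- int N..int N} - {- int n..int n}"
    hence "j = I (nat (\<bar>j\<bar> - int n - 1)) \<or> j = - I (nat (\<bar>j\<bar> - int n - 1))" "nat (\<bar>j\<bar> - int n - 1) < N"
      by (auto simp: I_def)
    thus "j \<in> I ` {..<N} \<union> (\<lambda>k. - I k) ` {..<N}" by blast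
  qed
  hence "sum ?e ({- int N..int N} - {- int n..int n}) \<le> sum ?e (I ` {..<N} \<union> (\<lambda>k. - I k) ` {..<N})"
    by (intro sum_mono2) auto
  also have "\<dots> = sum ?e (I ` {..<N}) + sum ?e ((\<lambda>k. - I k) ` {..<N})"
    by (intro sum.union_disjoint) (auto simp: I_def)
  also have "\<dots> = 2 * (\<Sum>k<N. ?e (I k))"
  proof -
    have "?e (- I k) = ?e (I k)" for k
      unfolding of_int_minus mult_minus_left sinh_minus abs_minus_cancel ..
    moreover have "inj_on (\<lambda>k. - I k) {..<N}" by (auto simp: inj_on_def I_def)
    ultimately have "sum ?e ((\<lambda>k. - I k) ` {..<N}) = (\<Sum>k<N. ?e (I k))"
      by (simp only: sum.reindex o_def)
    moreover have "sum ?e (I ` {..<N}) = (\<Sum>k<N. ?e (I k))"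
      by (subst sum.reindex) (auto simp: inj_on_def I_def)
    ultimately show ?thesis by simp
  qed
  also have "(\<Sum>k<N. ?e (I k)) \<le> (\<Sum>k<N. exp (- (a * sinh (real n * h))) * (q * q ^ k))"
  proof (rule sum_mono)
    fix k :: nat
    let ?u = "real n * h" and ?v = "(1 + real k) * h"
    have uv: "?u \<ge> 0" "?v \<ge> 0" using assms by auto
    have "sinh ?u + ?v \<le> sinh ?u * 1 + 1 * sinh ?v"
      using real_le_x_sinh[OF uv(2)] by (simp add: sinh_def exp_minus)
    also have "\<dots> \<le> sinh ?u * cosh ?v + cosh ?u * sinh ?v"
      using uv by (intro add_mono mult_left_mono mult_right_mono cosh_real_ge_1) auto
    also have "\<dots> = sinh (of_int (I k) * h)"
    proof -
      have "of_int (I k) * h = ?u + ?v" by (simp add: I_def algebra_simps)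
      thus ?thesis by (simp only: sinh_add)
    qed
    finally have "sinh ?u + ?v \<le> \<bar>sinh (of_int (I k) * h)\<bar>" by linarith
    hence "a * (sinh ?u + ?v) \<le> a * \<bar>sinh (of_int (I k) * h)\<bar>" using assms by (intro mult_left_mono) auto
    hence "?e (I k) \<le> exp (- (a * sinh ?u) + - (a * ?v))" by (simp add: algebra_simps)
    also have "\<dots> = exp (- (a * sinh ?u)) * (q * q ^ k)"
    proof -
      have "a * ?v = real (Suc k) * (a * h)" by simp
      hence "exp (- (a * ?v)) = q ^ Suc k" unfolding q_def exp_of_nat_mult[symmetric] by simp
      thus ?thesis by (simp only: exp_add power_Suc)
    qed
    finally show "?e (I k) \<le> exp (- (a * sinh ?u)) * (q * q ^ k)" .
  qed
  also have "\<dots> = exp (- (a * sinh (real n * h))) * (q * (\<Sum>k<N. q ^ k))"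
    by (simp add: sum_distrib_left)
  also have "\<dots> \<le> exp (- (a * sinh (real n * h))) * (1 / (a * h))"
  proof (rule mult_left_mono)
    have "(\<Sum>k<N. q ^ k) \<le> 1 / (1 - q)"
      using q by (subst sum_gp_strict) (auto intro!: divide_right_mono)
    hence "q * (\<Sum>k<N. q ^ k) \<le> q * (1 / (1 - q))" using q by (intro mult_left_mono) auto
    also have "\<dots> \<le> 1 / (a * h)"
    proof -
      have "exp (a * h) * q = 1" unfolding q_def exp_add[symmetric] by simp
      hence "1 / q = exp (a * h)" using q by (simp add: field_simps)
      hence "1 + a * h \<le> 1 / q" using exp_ge_add_one_self[of "a * h"] by simp
      hence "a * h * q \<le> 1 - q" using q by (simp add: field_simps)
      thus ?thesis using q assms by (simp add: field_simps)
    qed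
    finally show "q * (\<Sum>k<N. q ^ k) \<le> 1 / (a * h)" .
  qed simp
  finally show ?thesis by simp
qed

section \<open>The approximation theorem\<close>

text \<open>
  The step size makes sinh(nh) = dn/\<mu>. The discretization error is of the order of
  e^{-\<pi>d/h}, which is the claimed bound. The truncation error is of the order of
  n e^{-\<kappa> n} with \<kappa> = ad/\<mu>, which is smaller for large n whatever the decay rate a
  is; only the constant depends on a.
\<close>

lemma DE_sinc_approximation:
  fixes F :: "complex \<Rightarrow> complex" and a d K \<mu> :: real
  assumes F: "F holomorphic_on strip d" and pos: "0 < d" "0 < \<mu>" "0 < a" "0 < K"
    and decay: "\<And>z. z \<in> strip d \<Longrightarrow> norm (F z) \<le> K * exp (- (a * \<bar>sinh (Re z)\<bar>))"
  obtains C where "C > 0"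
    "\<And>n x. n > 0 \<Longrightarrow>
      norm (F (of_real x) - (\<Sum>j\<in>{- int n..int n}.
        F (of_real (of_int j * (arsinh (d * real n / \<mu>) / real n))) *
          of_real (Sinc j (arsinh (d * real n / \<mu>) / real n) x)))
      \<le> C * exp (- (pi * d * real n / arsinh (d * real n / \<mu>)))"
proof -
  define K' where "K' = K * (1 + 2 / a\<^sup>2)"
  define \<kappa> where "\<kappa> = a * d / \<mu>"
  have \<kappa>: "\<kappa> > 0" using pos by (simp add: \<kappa>_def)
  define A1 where "A1 = arsinh (d / \<mu>)"
  have A1: "A1 > 0" using pos by (simp add: A1_def)
  have K': "K' > 0" using pos by (simp add: K'_def add_pos_nonneg)
  obtain B where B: "\<And>n::nat. n > 0 \<Longrightarrow> pi * d * real n / arsinh (d / \<mu> * real n) \<le> \<kappa> / 2 * real n + B"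
    using linear_over_arsinh_le[of "pi * d" "d / \<mu>" "\<kappa> / 2"] pos \<kappa> by auto
  define D where "D = 1 - exp (- (2 * pi * \<mu>))"
  have D: "D > 0" using pos by (simp add: D_def)
  define C1 where "C1 = 2 * K' / (d * D)"
  define C2 where "C2 = 4 * K / (a * A1 * \<kappa>) * exp B"
  have C1: "C1 > 0" using K' pos D by (simp add: C1_def)
  have C2: "C2 > 0" using pos A1 \<kappa> by (simp add: C2_def)
  have quad: "norm (F z) \<le> K' / (1 + (Re z)\<^sup>2)" if "z \<in> strip d" for z
  proof -
    have "norm (F z) \<le> K * ((1 + 2 / a\<^sup>2) / (1 + (Re z)\<^sup>2))"
      using decay[OF that] exp_minus_sinh_le_inverse_quadratic[OF \<open>0 < a\<close>, of "Re z"] pos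
      by (meson mult_left_mono less_imp_le order_trans)
    thus ?thesis by (simp add: K'_def)
  qed
  have main: "norm (F (of_real x) - (\<Sum>j\<in>{- int n..int n}. F (of_real (of_int j * h)) * of_real (Sinc j h x)))
      \<le> (C1 + C2) * exp (- (pi * d * real n / A))"
    if n: "n > 0" and A_def: "A = arsinh (d * real n / \<mu>)" and h_def: "h = A / real n" for n x A h
  proof -
    have A: "A1 \<le> A" unfolding A1_def A_def using n pos by (intro mono_arsinh divide_right_mono) simp_all
    have "A > 0" using A A1 by linarith
    have h: "h > 0" using \<open>A > 0\<close> n by (simp add: h_def)
    define P where "P = pi * d * real n / A"
    have Ph: "pi / h * d = P" using n \<open>A > 0\<close> by (simp add: P_def h_def)
    have sinh_nh: "sinh (real n * h) = d * real n / \<mu>" using n by (simp add: h_def A_def)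
    let ?T = "K * (2 * exp (- (a * sinh (real n * h))) / (a * h))"
    have "norm (F (of_real x) - (\<Sum>j\<in>{- int n..int n}. F (of_real (of_int j * h)) * of_real (Sinc j h x)))
        \<le> K' / (d * sinh (pi / h * d)) + ?T"
    proof (rule truncated_cardinal_series_error[OF F \<open>0 < d\<close> h quad])
      fix N :: nat
      have "(\<Sum>j\<in>{- int N..int N} - {- int n..int n}. norm (F (of_real (of_int j * h))))
          \<le> (\<Sum>j\<in>{- int N..int N} - {- int n..int n}. K * exp (- (a * \<bar>sinh (of_int j * h)\<bar>)))"
      proof (rule sum_mono)
        fix j :: int
        show "norm (F (of_real (of_int j * h))) \<le> K * exp (- (a * \<bar>sinh (of_int j * h)\<bar>))"
          using decay[OF of_real_in_strip[OF \<open>0 < d\<close>, of "of_int j * h"]] by (simp only: Re_complex_of_real)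
      qed
      also have "\<dots> \<le> ?T"
        unfolding sum_distrib_left[symmetric] using sum_double_exponential_tail[OF \<open>0 < a\<close> h] pos
        by (intro mult_left_mono) auto
      finally show "(\<Sum>j\<in>{- int N..int N} - {- int n..int n}. norm (F (of_real (of_int j * h)))) \<le> ?T" .
    qed
    \<comment> \<open>P is bounded below uniformly in n because arsinh x is at most x; hence sinh P is at least a
      fixed multiple of exp P.\<close>
    also have "K' / (d * sinh (pi / h * d)) \<le> C1 * exp (- P)"
    proof -
      have "pi * \<mu> \<le> P"
      proof -
        have "A \<le> d * real n / \<mu>" unfolding A_def using pos by (intro arsinh_le_self) auto
        hence "A * \<mu> \<le> d * real n" using pos by (simp add: field_simps)
        hence "pi * (A * \<mu>) \<le> pi * (d * real n)" by (intro mult_left_mono) auto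
        thus ?thesis using \<open>A > 0\<close> by (simp add: P_def field_simps)
      qed
      hence "exp (- (2 * P)) \<le> exp (- (2 * pi * \<mu>))" by simp
      hence "exp P * D \<le> exp P * (1 - exp (- (2 * P)))" by (intro mult_left_mono) (auto simp: D_def)
      also have "\<dots> = 2 * sinh P"
      proof -
        have "exp P * exp (- (2 * P)) = exp (- P)" unfolding exp_add[symmetric] by simp
        thus ?thesis by (simp add: sinh_def right_diff_distrib)
      qed
      finally have sinh_ge: "d * (exp P * D / 2) \<le> d * sinh P" using pos by (intro mult_left_mono) auto
      have "K' / (d * sinh P) \<le> K' / (d * (exp P * D / 2))"
        by (rule frac_le[OF _ _ _ sinh_ge]) (use K' D pos in simp_all)
      also have "\<dots> = C1 * exp (- P)" by (simp add: C1_def exp_minus field_simps)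
      finally show ?thesis unfolding Ph .
    qed
    also have "?T \<le> C2 * exp (- P)"
    proof -
      have "1 / h \<le> real n / A1" using A A1 n by (simp add: h_def frac_le)
      hence "2 * K / a * exp (- (\<kappa> * real n)) * (1 / h) \<le> 2 * K / a * exp (- (\<kappa> * real n)) * (real n / A1)"
        using pos by (intro mult_left_mono) auto
      moreover have "?T = 2 * K / a * exp (- (\<kappa> * real n)) * (1 / h)"
        unfolding sinh_nh by (simp add: \<kappa>_def)
      ultimately have "?T \<le> 2 * K / a * exp (- (\<kappa> * real n)) * (real n / A1)" by (simp only:)
      also have "\<dots> = 2 * K / (a * A1) * (real n * exp (- (\<kappa> * real n)))" by simp
      also have "\<dots> \<le> 2 * K / (a * A1) * (2 / \<kappa> * (exp B * exp (- P)))"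
      proof (rule mult_left_mono)
        have "real n * exp (- (\<kappa> * real n)) \<le> 2 / \<kappa> * exp (- (\<kappa> / 2 * real n))"
        proof -
          have "\<kappa> / 2 * real n \<le> exp (\<kappa> / 2 * real n)"
            using exp_ge_add_one_self[of "\<kappa> / 2 * real n"] by linarith
          hence "real n \<le> 2 / \<kappa> * exp (\<kappa> / 2 * real n)" using \<kappa> by (simp add: field_simps)
          hence "real n * exp (- (\<kappa> * real n)) \<le> 2 / \<kappa> * exp (\<kappa> / 2 * real n) * exp (- (\<kappa> * real n))"
            by (rule mult_right_mono) simp
          also have "\<dots> = 2 / \<kappa> * exp (- (\<kappa> / 2 * real n))"
            unfolding mult.assoc exp_add[symmetric] by simp
          finally show ?thesis .
        qed
        also have "\<dots> \<le> 2 / \<kappa> * (exp B * exp (- P))"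
        proof (rule mult_left_mono)
          show "exp (- (\<kappa> / 2 * real n)) \<le> exp B * exp (- P)"
            using B[OF n] unfolding exp_add[symmetric] by (simp add: P_def A_def)
        qed (use \<kappa> in simp)
        finally show "real n * exp (- (\<kappa> * real n)) \<le> 2 / \<kappa> * (exp B * exp (- P))" .
      qed (use pos A1 in simp)
      also have "\<dots> = C2 * exp (- P)" by (simp add: C2_def)
      finally show ?thesis .
    qed
    finally show ?thesis by (simp add: P_def distrib_right)
  qed
  show ?thesis using that[of "C1 + C2"] C1 C2 main[OF _ refl refl] by auto
qed

lemma DE_phi_inv:
  assumes "t > 0"
  shows "DE_phi (of_real (DE_phi_inv t)) = of_real t"
  unfolding DE_phi_inv_def by (rule theI'[OF DE_phi_real_bij[OF assms]])

theorem theorem2p4: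
  fixes d \<mu> C0 :: real
    and p q :: complex
    and ft f :: "complex \<Rightarrow> complex"
  assumes "0 < d" and "d < pi/2"
    and "((\<lambda>t::real. ft (of_real t)) \<longlongrightarrow> p) at_top"
    and "((\<lambda>t::real. ft (of_real t)) \<longlongrightarrow> q) (at_right 0)"
    and "\<And>z. f z = ft z - (q + p * (exp z - 1)) / exp z"
    and "f analytic_on (DE_phi ` strip d)"
    and "0 < C0" and "0 < \<mu>" and "\<mu> \<le> 1"
    and "\<And>z. z \<in> DE_phi ` strip d \<Longrightarrow>
           norm (f z) \<le> C0 * norm z powr \<mu> * norm (exp (- z)) powr \<mu>"
  shows "\<exists>C>0. \<forall>n::nat. n > 0 \<longrightarrow>
    (let h = arsinh (d * real n / \<mu>) / real n in
      (SUP t\<in>{0<..}. ereal (norm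
        (ft (of_real t) -
          ((q + p * (exp (of_real t) - 1)) / exp (of_real t) +
           (\<Sum>j\<in>{- int n..int n}.
             (ft (DE_phi (of_real (of_int j * h))) -
               (q + p * of_real (exp (pi * sinh (of_int j * h)))) /
               (1 + of_real (exp (pi * sinh (of_int j * h))))) *
             of_real (Sinc j h (DE_phi_inv t)))))))
      \<le> ereal (C * exp (- (pi * d * real n) / arsinh (d * real n / \<mu>))))"
proof -
  define F where "F = (\<lambda>z. f (DE_phi z))"
  have sub: "strip d \<subseteq> strip (pi/2)" using \<open>d < pi/2\<close> by (auto simp: strip_def)
  have F_hol: "F holomorphic_on strip d"
  proof -
    have "f \<circ> DE_phi holomorphic_on strip d"
      using assms(6) by (intro holomorphic_on_compose holomorphic_on_subset[OF DE_phi_holomorphic sub]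
          analytic_imp_holomorphic)
    thus ?thesis by (simp add: F_def o_def)
  qed
  obtain K where K: "K > 0" "\<And>z. z \<in> strip d \<Longrightarrow>
      norm (DE_phi z) * norm (exp (- DE_phi z)) \<le> K * exp (- (pi * cos d / 2 * \<bar>sinh (Re z)\<bar>))"
    using DE_phi_exp_bound[OF assms(1,2)] by blast
  define a where "a = \<mu> * (pi * cos d / 2)"
  have a: "a > 0" using cos_gt_zero_pi[of d] assms(1,2,8) by (simp add: a_def)
  have decay: "norm (F z) \<le> C0 * K powr \<mu> * exp (- (a * \<bar>sinh (Re z)\<bar>))" if z: "z \<in> strip d" for z
  proof -
    have "norm (F z) \<le> C0 * (norm (DE_phi z) powr \<mu> * norm (exp (- DE_phi z)) powr \<mu>)"
      using assms(10)[of "DE_phi z"] z by (simp only: F_def imageI mult.assoc)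
    also have "\<dots> = C0 * (norm (DE_phi z) * norm (exp (- DE_phi z))) powr \<mu>"
      by (simp only: powr_mult norm_ge_zero)
    also have "\<dots> \<le> C0 * (K * exp (- (pi * cos d / 2 * \<bar>sinh (Re z)\<bar>))) powr \<mu>"
      using assms(7,8) K(2)[OF z] by (intro mult_left_mono powr_mono2) auto
    also have "\<dots> = C0 * K powr \<mu> * exp (- (a * \<bar>sinh (Re z)\<bar>))"
      using K(1) by (simp add: powr_mult exp_powr_real a_def mult_ac)
    finally show ?thesis .
  qed
  have "0 < C0 * K powr \<mu>" using K(1) assms(7) by simp
  from DE_sinc_approximation[OF F_hol assms(1,8) a this decay]
  obtain C where C: "C > 0" "\<And>n x. n > 0 \<Longrightarrow>
      norm (F (of_real x) - (\<Sum>j\<in>{- int n..int n}.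
        F (of_real (of_int j * (arsinh (d * real n / \<mu>) / real n))) *
          of_real (Sinc j (arsinh (d * real n / \<mu>) / real n) x)))
      \<le> C * exp (- (pi * d * real n / arsinh (d * real n / \<mu>)))"
    by blast
  \<comment> \<open>The subtracted boundary term at a node is the one of f, because exp (DE_phi y) = 1 + exp (pi sinh y).\<close>
  have node: "ft (DE_phi (of_real y)) - (q + p * of_real (exp (pi * sinh y))) / (1 + of_real (exp (pi * sinh y)))
      = F (of_real y)" for y :: real
  proof -
    have "exp (DE_phi (of_real y)) = 1 + of_real (exp (pi * sinh y))"
      using exp_DE_phi[OF of_real_in_strip[of "pi/2" y]] one_plus_exp_of_real[of y] by simp
    thus ?thesis unfolding F_def assms(5) by simp
  qed
  show ?thesis
    unfolding Let_def node
  proof (intro exI[of _ C] conjI allI impI SUP_least)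
    fix n :: nat and t :: real
    assume n: "n > 0" and "t \<in> {0<..}"
    hence "F (of_real (DE_phi_inv t)) = ft (of_real t) - (q + p * (exp (of_real t) - 1)) / exp (of_real t)"
      by (simp add: F_def DE_phi_inv assms(5))
    with C(2)[OF n, of "DE_phi_inv t"]
    show "ereal (norm (ft (of_real t) - ((q + p * (exp (of_real t) - 1)) / exp (of_real t) +
        (\<Sum>j\<in>{- int n..int n}. F (of_real (of_int j * (arsinh (d * real n / \<mu>) / real n))) *
          of_real (Sinc j (arsinh (d * real n / \<mu>) / real n) (DE_phi_inv t))))))
      \<le> ereal (C * exp (- (pi * d * real n) / arsinh (d * real n / \<mu>)))"
      unfolding ereal_less_eq minus_divide_left[symmetric] by (simp only: diff_diff_eq)
  qed (rule C(1))
qed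

end
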